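(* Let $N\geq 2$. There is a holomorphic function $f$ on $\mathbb{B}_N$ such that $\mathrm{Re}\, f$ is unbounded on every path of finite length that ends on $b\mathbb{B}_N$; that is, whenever $p\colon[0,1]\to\overline{\mathbb{B}_N}$ is a path of finite length such that $|p(t)|<1$ for $0\leq t<1$ and $|p(1)|=1$, the function $t\mapsto \mathrm{Re}\,\bigl(f(p(t))\bigr)$ is unbounded on $[0,1)$.
   Context: $\mathbb{B}_N$ is the open unit ball of $\mathbb{C}^N$, $b\mathbb{B}_N$ is its boundary (the unit sphere), and $|\cdot|$ is the Euclidean norm. A path is a continuous map. *)

theory Defs
  imports "HOL-Analysis.Analysis"
begin

text \<open>
  Holomorphy of a function of several complex variables: at every point of the open set \<open>U\<close>
  the (Frechet) derivative exists and is complex linear. Mere \<open>has_derivative\<close> gives only a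
  real-linear derivative, hence the second conjunct. The derivative is taken with respect to
  full neighbourhoods, so the notion is only meant for open \<open>U\<close>.
\<close>

definition holomorphic_several_on ::
  "(complex ^ 'n \<Rightarrow> complex) \<Rightarrow> (complex ^ 'n::finite) set \<Rightarrow> bool"
  where "holomorphic_several_on f U \<longleftrightarrow>
    (\<forall>z\<in>U. \<exists>D. (f has_derivative D) (at z) \<and> (\<forall>c v. D (c *s v) = c * D v))"

text \<open>
  Finite length on \<open>[0,1]\<close>: the lengths of the polygons inscribed at the partitions
  \<open>0 = t 0 < \<dots> < t n = 1\<close> are bounded. Only the values of \<open>t\<close> on \<open>{..n}\<close> matter.
\<close>

definition finite_length :: "(real \<Rightarrow> 'a::metric_space) \<Rightarrow> bool"
  where "finite_length p \<longleftrightarrow>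
    bdd_above {(\<Sum>i<n. dist (p (t i)) (p (t (Suc i)))) | n t.
      t 0 = 0 \<and> t n = 1 \<and> strict_mono_on {..n} t}"

end

theory Submission
  imports Defs "HOL-Complex_Analysis.Cauchy_Integral_Formula" "HOL-Real_Asymp.Real_Asymp"
begin

text \<open>
  The function \<open>f\<close> is a limit of entire functions with \<open>Re f \<ge> n\<close> on the \<open>n\<close>-th level of a
  labyrinth of discs tangent to spheres of radii increasing to 1. The discs of one level are so far
  apart that each is separated by a real hyperplane from the others and from the ball inside;
  hence it suffices to find, in one variable, entire functions that are close to 0 on
  \<open>{|w| \<le> L, Re w \<le> -\<eta>}\<close> and close to 1 on \<open>{|w| \<le> L, Re w \<ge> \<eta>}\<close>. Newton's iteration
  \<open>y \<mapsto> (y + 1/y) / 2\<close> approximates the sign of \<open>Re w\<close> by rational functions with poles on the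
  imaginary axis, and Runge's pole pushing makes them entire.

  The discs of \<open>m\<close> consecutive levels (the \<open>k\<close>-th block) have the same radius \<open>\<rho>\<^sub>k\<close> and, seen from
  the origin, together cover the sphere. A path that crosses the block without meeting them moves
  sideways by a multiple of \<open>\<rho>\<^sub>k\<close>, whereas the block only needs thickness of order \<open>\<rho>\<^sub>k\<^sup>2\<close>, because
  a disc of radius \<open>\<rho>\<close> tangent to a sphere leaves it by \<open>O(\<rho>\<^sup>2)\<close>. With \<open>\<rho>\<^sub>k\<close> proportional to
  \<open>1 / (k + 1)\<close>, infinitely many blocks fit into the ball, and a path to the sphere along which
  \<open>Re f\<close> is bounded has infinite length.
\<close>

section \<open>Entire approximation of step functions\<close>

definition entire_closure :: "complex set \<Rightarrow> (complex \<Rightarrow> complex) set"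
  where "entire_closure K =
    {g. \<forall>e>0. \<exists>h. h holomorphic_on UNIV \<and> (\<forall>w\<in>K. norm (g w - h w) < e)}"

lemma entire_closureI:
  assumes "\<And>e. e > 0 \<Longrightarrow> \<exists>h. h holomorphic_on UNIV \<and> (\<forall>w\<in>K. norm (g w - h w) < e)"
  shows "g \<in> entire_closure K"
  using assms by (auto simp: entire_closure_def)

lemma entire_closureD:
  assumes "g \<in> entire_closure K" "e > 0"
  obtains h where "h holomorphic_on UNIV" "\<And>w. w \<in> K \<Longrightarrow> norm (g w - h w) < e"
  using assms by (auto simp: entire_closure_def)

lemma entire_closure_entire:
  assumes "h holomorphic_on UNIV"
  shows "h \<in> entire_closure K"
  using assms by (intro entire_closureI exI[of _ h]) auto

lemma entire_closure_const: "(\<lambda>_. c) \<in> entire_closure K"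
  by (intro entire_closure_entire holomorphic_intros)

lemma entire_closure_add:
  assumes "f \<in> entire_closure K" "g \<in> entire_closure K"
  shows "(\<lambda>w. f w + g w) \<in> entire_closure K"
proof (rule entire_closureI)
  fix e :: real assume "e > 0"
  then have e: "e / 2 > 0" by simp
  obtain h1 where h1: "h1 holomorphic_on UNIV" "\<And>w. w \<in> K \<Longrightarrow> norm (f w - h1 w) < e / 2"
    using entire_closureD[OF assms(1) e] by blast
  obtain h2 where h2: "h2 holomorphic_on UNIV" "\<And>w. w \<in> K \<Longrightarrow> norm (g w - h2 w) < e / 2"
    using entire_closureD[OF assms(2) e] by blast
  show "\<exists>h. h holomorphic_on UNIV \<and> (\<forall>w\<in>K. norm (f w + g w - h w) < e)"
  proof (intro exI conjI ballI)
    show "(\<lambda>w. h1 w + h2 w) holomorphic_on UNIV"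
      by (intro holomorphic_intros h1 h2)
    fix w assume w: "w \<in> K"
    show "norm (f w + g w - (h1 w + h2 w)) < e"
      using norm_diff_triangle_ineq[of "f w" "g w" "h1 w" "h2 w"] h1(2)[OF w] h2(2)[OF w] by linarith
  qed
qed

lemma entire_closure_limit:
  assumes "\<And>e. e > 0 \<Longrightarrow> \<exists>g\<in>entire_closure K. \<forall>w\<in>K. norm (f w - g w) < e"
  shows "f \<in> entire_closure K"
proof (rule entire_closureI)
  fix e :: real assume "e > 0"
  then have e: "e / 2 > 0" by simp
  obtain g where g: "g \<in> entire_closure K" "\<And>w. w \<in> K \<Longrightarrow> norm (f w - g w) < e / 2"
    using assms[OF e] by blast
  obtain h where h: "h holomorphic_on UNIV" "\<And>w. w \<in> K \<Longrightarrow> norm (g w - h w) < e / 2"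
    using entire_closureD[OF g(1) e] by blast
  show "\<exists>h. h holomorphic_on UNIV \<and> (\<forall>w\<in>K. norm (f w - h w) < e)"
  proof (intro exI conjI ballI)
    show "h holomorphic_on UNIV" by fact
    fix w assume w: "w \<in> K"
    show "norm (f w - h w) < e"
      using norm_triangle_ineq[of "f w - g w" "g w - h w"] g(2)[OF w] h(2)[OF w] by simp
  qed
qed

lemma entire_bounded:
  assumes "h holomorphic_on UNIV" "compact K"
  obtains B where "B > 0" "\<And>w. w \<in> K \<Longrightarrow> norm (h w) \<le> B"
proof -
  have "continuous_on K h"
    using assms(1) holomorphic_on_imp_continuous_on continuous_on_subset by blast
  then have "bounded (h ` K)"
    using assms(2) compact_continuous_image compact_imp_bounded by blast
  then show thesis using that by (auto simp: bounded_pos)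
qed

lemma entire_closure_bounded:
  assumes "g \<in> entire_closure K" "compact K"
  obtains B where "B > 0" "\<And>w. w \<in> K \<Longrightarrow> norm (g w) \<le> B"
proof -
  obtain h where h: "h holomorphic_on UNIV" "\<And>w. w \<in> K \<Longrightarrow> norm (g w - h w) < 1"
    using entire_closureD[OF assms(1), of 1] by auto
  obtain B where B: "B > 0" "\<And>w. w \<in> K \<Longrightarrow> norm (h w) \<le> B"
    using entire_bounded[OF h(1) assms(2)] by blast
  show thesis
  proof
    show "B + 1 > 0" using B by simp
    fix w assume w: "w \<in> K"
    show "norm (g w) \<le> B + 1"
      using norm_triangle_sub[of "g w" "h w"] h(2)[OF w] B(2)[OF w] by linarith
  qed
qed

lemma entire_closure_mult_entire:
  assumes "f \<in> entire_closure K" "h holomorphic_on UNIV" "compact K"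
  shows "(\<lambda>w. f w * h w) \<in> entire_closure K"
proof (rule entire_closureI)
  fix e :: real assume e: "e > 0"
  obtain B where B: "B > 0" "\<And>w. w \<in> K \<Longrightarrow> norm (h w) \<le> B"
    using entire_bounded[OF assms(2,3)] by blast
  have "e / B > 0" using e B by simp
  then obtain k where k: "k holomorphic_on UNIV" "\<And>w. w \<in> K \<Longrightarrow> norm (f w - k w) < e / B"
    using entire_closureD[OF assms(1)] by blast
  show "\<exists>k. k holomorphic_on UNIV \<and> (\<forall>w\<in>K. norm (f w * h w - k w) < e)"
  proof (intro exI conjI ballI)
    show "(\<lambda>w. k w * h w) holomorphic_on UNIV" by (intro holomorphic_intros k assms)
    fix w assume w: "w \<in> K"
    have "norm (f w * h w - k w * h w) = norm (f w - k w) * norm (h w)"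
      by (simp add: norm_mult[symmetric] algebra_simps)
    also have "\<dots> \<le> norm (f w - k w) * B" using B(2)[OF w] by (intro mult_left_mono) auto
    also have "\<dots> < e" using k(2)[OF w] B(1) by (simp add: field_simps)
    finally show "norm (f w * h w - k w * h w) < e" .
  qed
qed

lemma entire_closure_mult:
  assumes "f \<in> entire_closure K" "g \<in> entire_closure K" "compact K"
  shows "(\<lambda>w. f w * g w) \<in> entire_closure K"
proof (rule entire_closure_limit)
  fix e :: real assume e: "e > 0"
  obtain B where B: "B > 0" "\<And>w. w \<in> K \<Longrightarrow> norm (f w) \<le> B"
    using entire_closure_bounded[OF assms(1,3)] by blast
  have "e / B > 0" using e B by simp
  then obtain h where h: "h holomorphic_on UNIV" "\<And>w. w \<in> K \<Longrightarrow> norm (g w - h w) < e / B"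
    using entire_closureD[OF assms(2)] by blast
  show "\<exists>k\<in>entire_closure K. \<forall>w\<in>K. norm (f w * g w - k w) < e"
  proof (intro bexI ballI)
    show "(\<lambda>w. f w * h w) \<in> entire_closure K"
      by (rule entire_closure_mult_entire[OF assms(1) h(1) assms(3)])
    fix w assume w: "w \<in> K"
    have "norm (f w * g w - f w * h w) = norm (f w) * norm (g w - h w)"
      by (simp add: norm_mult[symmetric] algebra_simps)
    also have "\<dots> \<le> B * norm (g w - h w)" using B(2)[OF w] by (intro mult_right_mono) auto
    also have "\<dots> < e" using h(2)[OF w] B(1) by (simp add: field_simps)
    finally show "norm (f w * g w - f w * h w) < e" .
  qed
qed

section \<open>Geometric series and reciprocals in the closure of the entire functions\<close>

lemma entire_closure_power:
  assumes "f \<in> entire_closure K" "compact K"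
  shows "(\<lambda>w. f w ^ n) \<in> entire_closure K"
  by (induction n) (auto intro: entire_closure_const entire_closure_mult assms)

lemma entire_closure_sum:
  assumes "\<And>i. f i \<in> entire_closure K"
  shows "(\<lambda>w. \<Sum>i<(n::nat). f i w) \<in> entire_closure K"
  by (induction n) (auto intro: entire_closure_const entire_closure_add assms)

text \<open>The partial sums of the geometric series are polynomials in \<open>q\<close>, and the
  remainder \<open>q w ^ n / (1 - q w)\<close> is at most \<open>2 * (1 / 2) ^ n\<close> on
  \<open>K\<close>.\<close>

lemma entire_closure_geometric:
  assumes "q \<in> entire_closure K" "compact K" and le: "\<And>w. w \<in> K \<Longrightarrow> norm (q w) \<le> 1 / 2"
  shows "(\<lambda>w. inverse (1 - q w)) \<in> entire_closure K"
proof (rule entire_closure_limit)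
  fix e :: real assume e: "e > 0"
  obtain n where n: "(1 / 2 :: real) ^ n < e / 2"
    using real_arch_pow_inv[of "e / 2" "1 / 2"] e by auto
  show "\<exists>g\<in>entire_closure K. \<forall>w\<in>K. norm (inverse (1 - q w) - g w) < e"
  proof (intro bexI ballI)
    show "(\<lambda>w. \<Sum>i<n. q w ^ i) \<in> entire_closure K"
      by (intro entire_closure_sum entire_closure_power assms)
    fix w assume w: "w \<in> K"
    have lb: "norm (1 - q w) \<ge> 1 / 2"
      using norm_triangle_ineq2[of 1 "q w"] le[OF w] by simp
    then have nz: "1 - q w \<noteq> 0" by auto
    have "(1 - q w) * (\<Sum>i<n. q w ^ i) = 1 - q w ^ n"
      using one_diff_power_eq[of "q w" n] by simp
    then have "inverse (1 - q w) - (\<Sum>i<n. q w ^ i) = q w ^ n / (1 - q w)"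
      using nz by (simp add: field_simps)
    then have "norm (inverse (1 - q w) - (\<Sum>i<n. q w ^ i)) = norm (q w) ^ n / norm (1 - q w)"
      by (simp add: norm_divide norm_power)
    also have "\<dots> \<le> (1 / 2) ^ n / (1 / 2)"
      using lb le[OF w] by (intro frac_le power_mono) auto
    also have "\<dots> < e" using n by simp
    finally show "norm (inverse (1 - q w) - (\<Sum>i<n. q w ^ i)) < e" .
  qed
qed

text \<open>The pole of \<open>1 / (g - b)\<close> is pushed along the imaginary axis, in steps of \<open>\<eta> / 2\<close>,
  from far away to \<open>b = 0\<close>.\<close>

lemma entire_closure_inverse:
  assumes g: "g \<in> entire_closure K" and K: "compact K" and \<eta>: "\<eta> > 0"
    and le: "\<And>w. w \<in> K \<Longrightarrow> \<eta> \<le> \<bar>Re (g w)\<bar>"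
  shows "(\<lambda>w. inverse (g w)) \<in> entire_closure K"
proof -
  \<comment> \<open>All poles lie on the imaginary axis, so each keeps distance at least
    \<open>\<eta>\<close> from the values of \<open>g\<close> on \<open>K\<close>.\<close>
  define b :: "nat \<Rightarrow> complex" where "b n = \<i> * of_real (real n * \<eta> / 2)" for n
  have lb: "norm (g w - b n) \<ge> \<eta>" if "w \<in> K" for w n
    using abs_Re_le_cmod[of "g w - b n"] le[OF that] by (simp add: b_def)
  obtain B where B: "B > 0" "\<And>w. w \<in> K \<Longrightarrow> norm (g w) \<le> B"
    using entire_closure_bounded[OF g K] by blast
  \<comment> \<open>This puts \<open>b N\<close> at distance at least \<open>2 * B\<close> from 0,
    so that \<open>g w / b N\<close> is at most 1/2 in norm and the first reciprocal is a geometric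
    series in \<open>g\<close>.\<close>
  obtain N where N: "real N > 4 * B / \<eta>" using reals_Archimedean2 by blast
  have bN: "norm (b N) \<ge> 2 * B" "b N \<noteq> 0"
  proof -
    have "norm (b N) = real N * \<eta> / 2" using \<eta> by (simp add: b_def norm_mult)
    then show "norm (b N) \<ge> 2 * B" using N \<eta> by (simp add: field_simps)
    then show "b N \<noteq> 0" using B by auto
  qed
  have base: "(\<lambda>w. inverse (g w - b N)) \<in> entire_closure K"
  proof -
    have "(\<lambda>w. inverse (1 - g w * inverse (b N))) \<in> entire_closure K"
    proof (intro entire_closure_geometric entire_closure_mult g entire_closure_const K)
      fix w assume w: "w \<in> K"
      have "norm (g w) / norm (b N) \<le> B / (2 * B)"
        using B(1) B(2)[OF w] bN(1) by (intro frac_le) auto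
      then show "norm (g w * inverse (b N)) \<le> 1 / 2"
        using B(1) by (simp add: norm_divide flip: divide_inverse)
    qed
    then have "(\<lambda>w. (- inverse (b N)) * inverse (1 - g w * inverse (b N))) \<in> entire_closure K"
      by (intro entire_closure_mult entire_closure_const K)
    also have "(\<lambda>w. (- inverse (b N)) * inverse (1 - g w * inverse (b N))) = (\<lambda>w. inverse (g w - b N))"
    proof
      fix w
      have "g w - b N = - b N * (1 - g w * inverse (b N))" using bN(2) by (simp add: field_simps)
      then show "(- inverse (b N)) * inverse (1 - g w * inverse (b N)) = inverse (g w - b N)"
        by (simp only: inverse_mult_distrib inverse_minus_eq)
    qed
    finally show ?thesis .
  qed
  have step: "(\<lambda>w. inverse (g w - b n)) \<in> entire_closure K"
    if IH: "(\<lambda>w. inverse (g w - b (Suc n))) \<in> entire_closure K" for n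
  proof -
    \<comment> \<open>With \<open>v = g w - b (Suc n)\<close> the new denominator is
      \<open>v - d = v * (1 - d / v)\<close>, and \<open>d / v\<close> has norm at most
      \<open>(\<eta> / 2) / \<eta>\<close>: a second geometric series.\<close>
    define d where "d = - \<i> * of_real (\<eta> / 2)"
    have bd: "b n = b (Suc n) + d" by (simp add: b_def d_def field_simps)
    have nd: "norm d = \<eta> / 2" using \<eta> by (simp add: d_def norm_mult)
    have "(\<lambda>w. inverse (g w - b (Suc n)) * inverse (1 - d * inverse (g w - b (Suc n)))) \<in> entire_closure K"
    proof (intro entire_closure_geometric entire_closure_mult IH entire_closure_const K)
      fix w assume w: "w \<in> K"
      have "norm d / norm (g w - b (Suc n)) \<le> (\<eta> / 2) / \<eta>"
        using nd lb[OF w, of "Suc n"] \<eta> by (intro frac_le) auto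
      then show "norm (d * inverse (g w - b (Suc n))) \<le> 1 / 2"
        using \<eta> by (simp add: norm_divide flip: divide_inverse)
    qed
    \<comment> \<open>The factorisation is proved for points of \<open>K\<close>, where
      \<open>v\<close> is nonzero; \<open>entire_closure_limit\<close> with error 0 transfers
      membership.\<close>
    moreover have "norm (inverse (g w - b n) -
        inverse (g w - b (Suc n)) * inverse (1 - d * inverse (g w - b (Suc n)))) = 0" if w: "w \<in> K" for w
    proof -
      have nz: "g w - b (Suc n) \<noteq> 0" using lb[OF w, of "Suc n"] \<eta> by auto
      have "(g w - b (Suc n)) * (1 - d * inverse (g w - b (Suc n))) = g w - b n"
        using nz by (simp add: bd right_diff_distrib)
      then show ?thesis by (metis inverse_mult_distrib diff_self norm_zero)
    qed
    ultimately show ?thesis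
      by (intro entire_closure_limit) (metis (no_types, lifting))
  qed
  have "(\<lambda>w. inverse (g w - b 0)) \<in> entire_closure K"
    using base by (induction N) (auto intro: step)
  then show ?thesis by (simp add: b_def)
qed

text \<open>Newton's method for the equation \<open>y\<^sup>2 = 1\<close>; its iterates converge to the sign of the real
  part of the starting value.\<close>

primrec newton :: "nat \<Rightarrow> complex \<Rightarrow> complex" where
  "newton 0 w = w"
| "newton (Suc k) w = (newton k w + inverse (newton k w)) / 2"

section \<open>Entire approximability and convergence of Newton's iteration\<close>

lemma newton_minus: "newton k (- w) = - newton k w"
  by (induction k) (auto simp: field_simps)

text \<open>Inversion maps the right half-plane to itself, so one step at worst halves the real
  part.\<close>

lemma Re_newton_ge:
  assumes "Re w \<ge> \<eta>" "\<eta> > 0"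
  shows "Re (newton k w) \<ge> \<eta> / 2 ^ k"
proof (induction k)
  case 0
  then show ?case using assms by simp
next
  case (Suc k)
  have "0 < \<eta> / 2 ^ k" using assms by simp
  then have "Re (inverse (newton k w)) \<ge> 0" using Suc by simp
  then have "Re (newton k w + inverse (newton k w)) / 2 \<ge> \<eta> / 2 ^ k / 2"
    using Suc by (intro divide_right_mono) auto
  then show ?case by (simp add: field_simps)
qed

lemma abs_Re_newton_ge:
  assumes "\<bar>Re w\<bar> \<ge> \<eta>" "\<eta> > 0"
  shows "\<bar>Re (newton k w)\<bar> \<ge> \<eta> / 2 ^ k"
proof (cases "Re w \<ge> 0")
  case True
  then show ?thesis using Re_newton_ge[of \<eta> w k] assms by simp
next
  case False
  then show ?thesis using Re_newton_ge[of \<eta> "-w" k] assms by (simp add: newton_minus)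
qed

text \<open>The bound \<open>\<eta> / 2 ^ k\<close> keeps the iterates on \<open>K\<close> away from
  the imaginary axis, so \<open>entire_closure_inverse\<close> applies at each step.\<close>

lemma newton_entire_closure:
  assumes "compact K" "\<eta> > 0" "\<And>w. w \<in> K \<Longrightarrow> \<bar>Re w\<bar> \<ge> \<eta>"
  shows "newton k \<in> entire_closure K"
proof (induction k)
  case 0
  have "newton 0 = (\<lambda>w. w)" by auto
  then show ?case by (auto intro: entire_closure_entire)
next
  case (Suc k)
  have "(\<lambda>w. inverse (newton k w)) \<in> entire_closure K"
    by (rule entire_closure_inverse[OF Suc assms(1), of "\<eta> / 2 ^ k"])
      (use abs_Re_newton_ge assms in auto)
  then have "(\<lambda>w. (newton k w + inverse (newton k w)) * (1 / 2)) \<in> entire_closure K"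
    by (intro entire_closure_mult entire_closure_add entire_closure_const Suc assms)
  then show ?case by (simp add: fun_eq_iff[symmetric])
qed

text \<open>The Cayley transform \<open>(y - 1) / (y + 1)\<close> conjugates the Newton step to
  squaring. The product form avoids a division by \<open>newton k w + 1\<close>.\<close>

lemma newton_quotient:
  assumes "Re w > 0"
  shows "norm (newton k w - 1) = (norm (w - 1) / norm (w + 1)) ^ (2 ^ k) * norm (newton k w + 1)"
proof (induction k)
  case 0
  have "Re (w + 1) > 0" using assms by simp
  then have "w + 1 \<noteq> 0" by (metis less_irrefl zero_complex.sel(1))
  then show ?case by simp
next
  case (Suc k)
  let ?y = "newton k w"
  have "Re ?y > 0" using Re_newton_ge[of "Re w" w k] assms
    by (smt (verit) divide_pos_pos zero_less_power)
  then have nz: "?y \<noteq> 0" by auto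
  have "newton (Suc k) w - 1 = (?y - 1)\<^sup>2 / (2 * ?y)"
    using nz by (simp add: field_simps power2_eq_square)
  moreover have "newton (Suc k) w + 1 = (?y + 1)\<^sup>2 / (2 * ?y)"
    using nz by (simp add: field_simps power2_eq_square)
  ultimately show ?case
    using Suc by (simp add: norm_divide norm_power power_mult_distrib power_mult mult.commute flip: power_mult)
qed

lemma newton_uniform:
  assumes "L > 0" "\<eta> > 0" "e > 0"
  obtains k where "\<And>w. norm w \<le> L \<Longrightarrow> Re w \<ge> \<eta> \<Longrightarrow> norm (newton k w - 1) < e"
proof -
  \<comment> \<open>A uniform bound for the Cayley quotient, from
    \<open>|w - 1|^2 = |w + 1|^2 - 4 * Re w\<close>. The maximum with 0 guards the root for
    \<open>\<eta>\<close> so large that no \<open>w\<close> qualifies.\<close>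
  define \<theta> where "\<theta> = sqrt (max 0 (1 - 4 * \<eta> / (L + 1)\<^sup>2))"
  have \<theta>: "0 \<le> \<theta>" "\<theta> < 1" using assms by (auto simp: \<theta>_def)
  have quot: "norm (w - 1) / norm (w + 1) \<le> \<theta>" if w: "norm w \<le> L" "Re w \<ge> \<eta>" for w
  proof -
    have pos: "Re (w + 1) > 0" using w assms by simp
    then have nz: "w + 1 \<noteq> 0" by (metis less_irrefl zero_complex.sel(1))
    have ub: "norm (w + 1) \<le> L + 1" using norm_triangle_ineq[of w 1] w by simp
    have "(norm (w - 1))\<^sup>2 = (norm (w + 1))\<^sup>2 - 4 * Re w"
      unfolding cmod_power2 by (simp add: power2_eq_square algebra_simps)
    then have "(norm (w - 1) / norm (w + 1))\<^sup>2 = 1 - 4 * Re w / (norm (w + 1))\<^sup>2"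
      using nz by (simp add: power_divide diff_divide_distrib)
    also have "\<dots> \<le> 1 - 4 * \<eta> / (L + 1)\<^sup>2"
      using w ub nz assms by (intro diff_left_mono frac_le power_mono) auto
    also have "\<dots> \<le> max 0 (1 - 4 * \<eta> / (L + 1)\<^sup>2)" by simp
    finally show ?thesis unfolding \<theta>_def by (rule real_le_rsqrt)
  qed
  \<comment> \<open>From \<open>|y - 1| \<le> d * |y + 1| \<le> d * |y - 1| + 2 * d\<close> and
    \<open>d \<le> 1 / 2\<close> follows \<open>|y - 1| \<le> 4 * d \<le> e / 2\<close>.\<close>
  define d where "d = min (1 / 2) (e / 8)"
  have d: "d > 0" "d \<le> 1 / 2" "d \<le> e / 8" using assms by (auto simp: d_def)
  obtain k where k: "\<theta> ^ k < d" using real_arch_pow_inv[of d \<theta>] d \<theta> by auto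
  have k2: "\<theta> ^ (2 ^ k) < d"
    using power_decreasing[of k "2 ^ k" \<theta>] \<theta> k by (smt (verit) less_exp less_imp_le)
  show thesis
  proof
    fix w :: complex assume w: "norm w \<le> L" "Re w \<ge> \<eta>"
    let ?y = "newton k w"
    have "(norm (w - 1) / norm (w + 1)) ^ (2 ^ k) \<le> \<theta> ^ (2 ^ k)"
      by (intro power_mono quot w) auto
    then have "norm (?y - 1) \<le> d * norm (?y + 1)"
      using newton_quotient[of w k] w assms k2 mult_right_mono[of _ d "norm (?y + 1)"] by auto
    also have "norm (?y + 1) \<le> norm (?y - 1) + 2"
      using norm_triangle_ineq[of "?y - 1" 2] by (simp add: add.commute)
    finally have "norm (?y - 1) \<le> d * norm (?y - 1) + 2 * d"
      using d by (simp add: algebra_simps)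
    moreover have "d * norm (?y - 1) \<le> 1 / 2 * norm (?y - 1)"
      using d by (intro mult_right_mono) auto
    ultimately show "norm (?y - 1) < e" using d assms by linarith
  qed
qed

text \<open>An entire \<open>g\<close> approximates the limit values -1 and 1 of Newton's iteration
  up to \<open>2 * e\<close>; the map \<open>y \<mapsto> (1 + y) / 2\<close> turns these into 0 and
  1 and halves the error.\<close>

lemma entire_step_function:
  assumes "L > 0" "\<eta> > 0" "e > 0"
  obtains h where "h holomorphic_on UNIV"
    "\<And>w. norm w \<le> L \<Longrightarrow> Re w \<le> - \<eta> \<Longrightarrow> norm (h w) < e"
    "\<And>w. norm w \<le> L \<Longrightarrow> Re w \<ge> \<eta> \<Longrightarrow> norm (h w - 1) < e"
proof -
  obtain k where k: "\<And>w. norm w \<le> L \<Longrightarrow> Re w \<ge> \<eta> \<Longrightarrow> norm (newton k w - 1) < e"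
    using newton_uniform[OF assms] by blast
  define K where "K = cball (0::complex) L \<inter> {w. \<eta> \<le> \<bar>Re w\<bar>}"
  have "closed {w. \<eta> \<le> \<bar>Re w\<bar>}" by (intro closed_Collect_le continuous_intros)
  then have K: "compact K" unfolding K_def by (intro compact_Int_closed compact_cball)
  obtain g where g: "g holomorphic_on UNIV" "\<And>w. w \<in> K \<Longrightarrow> norm (newton k w - g w) < e"
    using entire_closureD[OF newton_entire_closure[OF K assms(2)] assms(3)] by (auto simp: K_def)
  have close: "norm (g w - c) < 2 * e" if "w \<in> K" "norm (newton k w - c) < e" for w c
    using norm_triangle_ineq[of "newton k w - c" "- (newton k w - g w)"] g(2)[OF that(1)] that(2)
    by (simp only: norm_minus_cancel) simp
  show thesis
  proof
    show "(\<lambda>w. (1 + g w) / 2) holomorphic_on UNIV" by (intro holomorphic_intros g) auto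
  next
    fix w :: complex assume w: "norm w \<le> L" "Re w \<le> - \<eta>"
    have "newton k w - (- 1) = - (newton k (- w) - 1)" by (simp add: newton_minus)
    then have "norm (newton k w - (- 1)) < e"
      using k[of "- w"] w by (simp only: norm_minus_cancel) simp
    then have "norm (g w - (- 1)) < 2 * e" using w by (intro close) (auto simp: K_def)
    then show "norm ((1 + g w) / 2) < e" by (simp add: norm_divide add.commute)
  next
    fix w :: complex assume w: "norm w \<le> L" "Re w \<ge> \<eta>"
    then have "norm (g w - 1) < 2 * e" using k assms by (intro close) (auto simp: K_def)
    moreover have "(1 + g w) / 2 - 1 = (g w - 1) / 2" by (simp add: field_simps)
    ultimately show "norm ((1 + g w) / 2 - 1) < e" by (simp only: norm_divide) simp
  qed
qed

section \<open>Holomorphic functions of several variables\<close>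

lemma holomorphic_several_on_subset:
  "holomorphic_several_on f U \<Longrightarrow> V \<subseteq> U \<Longrightarrow> holomorphic_several_on f V"
  by (auto simp: holomorphic_several_on_def)

lemma holomorphic_several_on_const: "holomorphic_several_on (\<lambda>_. c) U"
  unfolding holomorphic_several_on_def by (auto intro!: exI[of _ "\<lambda>_. 0"])

lemma holomorphic_several_on_add:
  assumes "holomorphic_several_on f U" "holomorphic_several_on g U"
  shows "holomorphic_several_on (\<lambda>z. f z + g z) U"
  unfolding holomorphic_several_on_def
proof
  fix z assume "z \<in> U"
  then obtain D E where "(f has_derivative D) (at z)" "\<And>c v. D (c *s v) = c * D v"
    "(g has_derivative E) (at z)" "\<And>c v. E (c *s v) = c * E v"
    using assms unfolding holomorphic_several_on_def by metis
  then show "\<exists>D. ((\<lambda>z. f z + g z) has_derivative D) (at z) \<and> (\<forall>c v. D (c *s v) = c * D v)"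
    by (intro exI[of _ "\<lambda>v. D v + E v"]) (auto intro: has_derivative_add simp: ring_distribs)
qed

lemma holomorphic_several_on_cmult:
  assumes "holomorphic_several_on f U"
  shows "holomorphic_several_on (\<lambda>z. a * f z) U"
  unfolding holomorphic_several_on_def
proof
  fix z assume "z \<in> U"
  then obtain D where "(f has_derivative D) (at z)" "\<And>c v. D (c *s v) = c * D v"
    using assms unfolding holomorphic_several_on_def by metis
  then show "\<exists>D. ((\<lambda>z. a * f z) has_derivative D) (at z) \<and> (\<forall>c v. D (c *s v) = c * D v)"
    by (intro exI[of _ "\<lambda>v. a * D v"]) (auto intro: has_derivative_mult_right)
qed

lemma holomorphic_several_on_diff:
  assumes "holomorphic_several_on f U" "holomorphic_several_on g U"
  shows "holomorphic_several_on (\<lambda>z. f z - g z) U"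
  using holomorphic_several_on_add[OF assms(1) holomorphic_several_on_cmult[OF assms(2), of "-1"]]
  by simp

lemma holomorphic_several_on_sum:
  assumes "finite I" "\<And>i. i \<in> I \<Longrightarrow> holomorphic_several_on (f i) U"
  shows "holomorphic_several_on (\<lambda>z. \<Sum>i\<in>I. f i z) U"
  using assms
  by (induction I) (auto intro: holomorphic_several_on_const holomorphic_several_on_add)

lemma holomorphic_several_on_imp_continuous_on:
  assumes "holomorphic_several_on f U"
  shows "continuous_on U f"
  using assms unfolding holomorphic_several_on_def
  by (meson continuous_at_imp_continuous_on has_derivative_continuous)

section \<open>The Hermitian product and Cauchy estimates on complex lines\<close>

lemma norm_vector_scalar_mult: "norm (c *s v) = norm c * norm (v :: complex ^ 'n)"
  by (simp add: norm_vec_def norm_mult L2_set_right_distrib)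

lemma bounded_linear_vector_scalar_mult:
  "bounded_linear (\<lambda>c. c *s (v :: complex ^ 'n))"
  by (intro bounded_linear_intro[of _ "norm v"])
    (auto simp: vec_eq_iff algebra_simps norm_vector_scalar_mult)

text \<open>The conjugate sits on \<open>u\<close>, which makes the product complex linear in
  \<open>z\<close>. Its real part is the real inner product, so real hyperplanes become vertical
  lines in the plane of \<open>cinner z u\<close>.\<close>

definition cinner :: "complex ^ 'n::finite \<Rightarrow> complex ^ 'n \<Rightarrow> complex"
  where "cinner z u = (\<Sum>i\<in>UNIV. z $ i * cnj (u $ i))"

lemma Re_cinner: "Re (cinner z u) = z \<bullet> u"
  by (simp add: cinner_def inner_vec_def inner_complex_def Re_sum)

lemma cinner_vector_scalar_mult: "cinner (c *s z) u = c * cinner z u"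
  by (simp add: cinner_def sum_distrib_left mult.assoc)

lemma bounded_linear_cinner: "bounded_linear (\<lambda>z. cinner z u)"
  unfolding cinner_def
  by (intro bounded_linear_sum bounded_linear_compose[OF bounded_linear_mult_left] bounded_linear_vec_nth)

lemma holomorphic_several_on_compose_cinner:
  fixes u :: "complex ^ 'n::finite"
  assumes "h holomorphic_on UNIV"
  shows "holomorphic_several_on (\<lambda>z. h (cinner z u)) UNIV"
  unfolding holomorphic_several_on_def
proof
  fix z :: "complex ^ 'n"
  have "(h has_field_derivative deriv h (cinner z u)) (at (cinner z u))"
    using assms holomorphic_derivI[OF assms open_UNIV] by simp
  then have "(h has_derivative (*) (deriv h (cinner z u))) (at (cinner z u))"
    by (simp add: has_field_derivative_def)
  then have "((\<lambda>z. h (cinner z u)) has_derivative (\<lambda>v. deriv h (cinner z u) * cinner v u)) (at z)"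
    by (rule has_derivative_compose[OF bounded_linear_imp_has_derivative[OF bounded_linear_cinner]])
  then show "\<exists>D. ((\<lambda>z. h (cinner z u)) has_derivative D) (at z) \<and> (\<forall>c v. D (c *s v) = c * D v)"
    by (intro exI conjI) (auto simp: cinner_vector_scalar_mult)
qed

text \<open>The Cauchy inequality on the complex line through \<open>z\<close> in the direction \<open>v\<close>.\<close>

lemma Cauchy_inequality_several:
  fixes F :: "complex ^ 'n::finite \<Rightarrow> complex"
  assumes F: "holomorphic_several_on F UNIV" and D: "(F has_derivative D) (at z)"
    and Dlin: "\<And>c v. D (c *s v) = c * D v"
    and r: "r > 0" and B: "\<And>w. w \<in> cball z r \<Longrightarrow> norm (F w) \<le> B"
  shows "norm (D v) \<le> B / r * norm v"
proof (cases "v = 0")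
  case True
  have "D 0 = 0" using D by (simp add: has_derivative_bounded_linear linear_simps)
  then show ?thesis using True by simp
next
  case False
  define g where "g = (\<lambda>\<zeta>. F (z + \<zeta> *s v))"
  have deriv: "(g has_field_derivative E v) (at \<zeta>)"
    if E: "(F has_derivative E) (at (z + \<zeta> *s v))" "\<And>c v. E (c *s v) = c * E v" for E \<zeta>
  proof -
    have "((\<lambda>\<zeta>. z + \<zeta> *s v) has_derivative (\<lambda>c. c *s v)) (at \<zeta>)"
      using has_derivative_add[OF has_derivative_const
          bounded_linear_imp_has_derivative[OF bounded_linear_vector_scalar_mult[of v]]] by simp
    from has_derivative_compose[OF this E(1)]
    show ?thesis by (simp add: has_field_derivative_def g_def E(2) mult.commute[of _ "E v"])
  qed
  have "g field_differentiable (at \<zeta>)" for \<zeta>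
    using F deriv unfolding holomorphic_several_on_def field_differentiable_def by blast
  then have holo: "g holomorphic_on A" for A
    by (auto simp: holomorphic_on_def field_differentiable_at_within)
  have "(g has_field_derivative D v) (at 0)" using deriv[of D 0] D Dlin by simp
  then have "deriv g 0 = D v" by (rule DERIV_imp_deriv)
  moreover have "norm ((deriv ^^ 1) g 0) \<le> fact 1 * B / (r / norm v) ^ 1"
  proof (rule Cauchy_inequality[OF holo])
    show "continuous_on (cball 0 (r / norm v)) g"
      by (rule holomorphic_on_imp_continuous_on[OF holo])
    show "0 < r / norm v" using r False by simp
    fix x :: complex assume "norm (0 - x) = r / norm v"
    then show "norm (g x) \<le> B"
      unfolding g_def using False by (intro B) (simp add: dist_norm norm_vector_scalar_mult)
  qed
  ultimately show ?thesis by simp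
qed

text \<open>Termwise differentiation: Cauchy's inequality turns the bounds for the terms on a ball
  into summable bounds for their derivatives on a smaller one, and complex linearity passes to the
  limit. The finitely many terms before the bounds set in are split off.\<close>

lemma holomorphic_several_on_series:
  fixes d :: "nat \<Rightarrow> complex ^ 'n::finite \<Rightarrow> complex"
  assumes d: "\<And>n. holomorphic_several_on (d n) UNIV"
    and bound: "\<And>R. R < 1 \<Longrightarrow> \<exists>N. \<forall>n\<ge>N. \<forall>z\<in>cball 0 R. norm (d n z) \<le> (1 / 2) ^ n"
  shows "holomorphic_several_on (\<lambda>z. \<Sum>n. d n z) (ball 0 1)"
  unfolding holomorphic_several_on_def
proof
  fix z0 :: "complex ^ 'n" assume z0: "z0 \<in> ball 0 1"
  \<comment> \<open>The derivatives are controlled on the ball of radius \<open>R\<close>; the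
    Cauchy radius \<open>\<delta>\<close> leads from there at most to radius \<open>R'\<close>,
    where the terms are still bounded.\<close>
  define R where "R = (1 + norm z0) / 2"
  define R' where "R' = (1 + R) / 2"
  define \<delta> where "\<delta> = R' - R"
  have R: "norm z0 < R" "R < R'" "R' < 1" "\<delta> > 0" using z0 by (auto simp: R_def R'_def \<delta>_def)
  obtain N where N: "\<And>n z. n \<ge> N \<Longrightarrow> norm z \<le> R' \<Longrightarrow> norm (d n z) \<le> (1 / 2) ^ n"
    using bound[OF R(3)] by (auto simp: Ball_def)
  obtain D where D: "\<And>n z. (d n has_derivative D n z) (at z)"
      "\<And>n z c v. D n z (c *s v) = c * D n z v"
    using d unfolding holomorphic_several_on_def by (metis UNIV_I)
  define S where "S = ball (0 :: complex ^ 'n) R"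
  define b where "b = (\<lambda>i. (1 / 2) ^ i / \<delta>)"
  have b: "summable b" unfolding b_def by (intro summable_divide summable_geometric) auto
  have eb: "norm (d (i + N) x) \<le> (1 / 2) ^ i" if "norm x \<le> R'" for i x
    by (rule order_trans[OF N power_decreasing]) (use that in auto)
  have Db: "norm (D (i + N) x v) \<le> b i * norm v" if "x \<in> S" for i x v
  proof -
    have "norm (d (i + N) w) \<le> (1 / 2) ^ i" if w: "w \<in> cball x \<delta>" for w
    proof (rule eb)
      have "norm w \<le> norm x + dist x w" by (metis dist_0_norm dist_triangle)
      then show "norm w \<le> R'" using w \<open>x \<in> S\<close> by (simp add: S_def \<delta>_def)
    qed
    from Cauchy_inequality_several[OF d D R(4) this] show ?thesis by (simp add: b_def)
  qed
  have summ: "summable (\<lambda>i. D (i + N) x v)" if "x \<in> S" for x v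
    using Db[OF that] by (intro summable_comparison_test'[OF summable_mult2[OF b]]) auto
  define G where "G = (\<lambda>x v. \<Sum>i. D (i + N) x v)"
  have "\<exists>g. \<forall>x\<in>S. (\<lambda>i. d (i + N) x) sums (g x) \<and> (g has_derivative G x) (at x within S)"
  proof (rule has_derivative_series)
    show "convex S" by (simp add: S_def)
    show "(d (i + N) has_derivative D (i + N) x) (at x within S)" for i x
      using D(1) has_derivative_at_withinI by blast
    show "\<forall>\<^sub>F n in sequentially. \<forall>x\<in>S. \<forall>v. norm ((\<Sum>i<n. D (i + N) x v) - G x v) \<le> e * norm v"
      if "e > 0" for e
    proof -
      have "(\<lambda>n. \<Sum>i. b (i + n)) \<longlonglongrightarrow> 0" by (rule suminf_exist_split2[OF b])
      then have "\<forall>\<^sub>F n in sequentially. (\<Sum>i. b (i + n)) < e"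
        using that by (rule order_tendstoD)
      then show ?thesis
      proof (rule eventually_mono, intro ballI allI)
        fix n x v assume n: "(\<Sum>i. b (i + n)) < e" and x: "x \<in> S"
        have bn: "summable (\<lambda>i. b (i + n))" using b by (simp add: summable_iff_shift)
        have "norm ((\<Sum>i<n. D (i + N) x v) - G x v) = norm (\<Sum>i. D (i + n + N) x v)"
          using suminf_minus_initial_segment[OF summ[OF x, of v], of n]
          by (simp add: G_def norm_minus_commute)
        also have "\<dots> \<le> (\<Sum>i. b (i + n) * norm v)"
          using Db[OF x] by (intro norm_suminf_le summable_mult2 bn) auto
        also have "\<dots> = (\<Sum>i. b (i + n)) * norm v" by (rule suminf_mult2[OF bn, symmetric])
        also have "\<dots> \<le> e * norm v" using n by (intro mult_right_mono) auto
        finally show "norm ((\<Sum>i<n. D (i + N) x v) - G x v) \<le> e * norm v" .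
      qed
    qed
    show "0 \<in> S" using R norm_ge_zero[of z0] by (simp add: S_def del: norm_ge_zero)
    have "summable (\<lambda>i. d (i + N) 0)"
      using eb[of 0] R norm_ge_zero[of z0]
      by (intro summable_comparison_test'[OF summable_geometric[of "1 / 2 :: real"]]) (auto simp del: norm_ge_zero)
    then show "(\<lambda>i. d (i + N) 0) sums (\<Sum>i. d (i + N) 0)" by (rule summable_sums)
  qed
  then obtain g where g: "\<And>x. x \<in> S \<Longrightarrow> (\<lambda>i. d (i + N) x) sums (g x)"
      "\<And>x. x \<in> S \<Longrightarrow> (g has_derivative G x) (at x within S)" by blast
  have z0S: "z0 \<in> S" and S: "open S" using R by (auto simp: S_def)
  have split: "(\<Sum>i<N. d i x) + g x = (\<Sum>n. d n x)" if "x \<in> S" for x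
  proof -
    have "(\<lambda>n. d n x) sums (g x + (\<Sum>i<N. d i x))"
      using g(1)[OF that] sums_iff_shift[of "\<lambda>n. d n x" N] by blast
    then show ?thesis by (simp add: sums_unique add.commute)
  qed
  have "(g has_derivative G z0) (at z0)"
    using g(2)[OF z0S] z0S S by (metis at_within_open)
  then have "((\<lambda>x. (\<Sum>i<N. d i x) + g x) has_derivative (\<lambda>v. (\<Sum>i<N. D i z0 v) + G z0 v)) (at z0)"
    by (intro has_derivative_add has_derivative_sum D)
  then have "((\<lambda>x. \<Sum>n. d n x) has_derivative (\<lambda>v. (\<Sum>i<N. D i z0 v) + G z0 v)) (at z0)"
    using S z0S split by (rule has_derivative_transform_within_open)
  moreover have "(\<Sum>i<N. D i z0 (c *s v)) + G z0 (c *s v) = c * ((\<Sum>i<N. D i z0 v) + G z0 v)" for c v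
    using summ[OF z0S, of v] by (simp add: D(2) G_def sum_distrib_left ring_distribs suminf_mult)
  ultimately show "\<exists>D. ((\<lambda>x. \<Sum>n. d n x) has_derivative D) (at z0) \<and> (\<forall>c v. D (c *s v) = c * D v)"
    by blast
qed

text \<open>Corrections are added inductively, the one at level \<open>n\<close> tiny on the ball of
  radius \<open>r n\<close> and huge on \<open>K n\<close>. As \<open>K n\<close> lies in the balls
  of all later levels, the later corrections cannot spoil what was gained on it.\<close>

lemma exists_holomorphic_large_on:
  fixes K :: "nat \<Rightarrow> (complex ^ 'n::finite) set"
  assumes large: "\<And>n A e. e > 0 \<Longrightarrow> \<exists>Q. holomorphic_several_on Q UNIV \<and>
      (\<forall>z\<in>cball 0 (r n). norm (Q z) \<le> e) \<and> (\<forall>z\<in>K n. A \<le> Re (Q z))"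
    and r: "incseq r" "r \<longlonglongrightarrow> 1" "\<And>n. r n < 1"
    and K: "\<And>n. K n \<subseteq> cball 0 (r (Suc n))"
  shows "\<exists>f. holomorphic_several_on f (ball 0 1) \<and> (\<forall>n. \<forall>z\<in>K n. real n \<le> Re (f z))"
proof -
  define P where "P = (\<lambda>n F G. (\<forall>z\<in>cball 0 (r n). norm (G z - F z) \<le> (1 / 2) ^ n) \<and>
      (\<forall>z\<in>K n. real n + 1 \<le> Re (G z :: complex)))"
  have "\<exists>F. \<forall>n. holomorphic_several_on (F n) UNIV \<and> P n (F n) (F (Suc n))"
  proof (rule dependent_nat_choice)
    show "\<exists>F :: complex ^ 'n \<Rightarrow> complex. holomorphic_several_on F UNIV"
      using holomorphic_several_on_const by blast
    fix F :: "complex ^ 'n \<Rightarrow> complex" and n assume F: "holomorphic_several_on F UNIV"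
    have "continuous_on (cball 0 1) F"
      using F holomorphic_several_on_imp_continuous_on continuous_on_subset by blast
    then have "bounded (F ` cball 0 1)"
      using compact_cball compact_continuous_image compact_imp_bounded by blast
    then obtain B where B: "\<And>z. z \<in> cball 0 1 \<Longrightarrow> norm (F z) \<le> B"
      unfolding bounded_iff by blast
    \<comment> \<open>The summand \<open>B\<close> outweighs the current function on the closed unit
      ball; the extra 1 is a reserve for all later corrections, whose sum is at most 1 on
      \<open>K n\<close>.\<close>
    obtain Q where Q: "holomorphic_several_on Q UNIV" "\<forall>z\<in>cball 0 (r n). norm (Q z) \<le> (1 / 2) ^ n"
        "\<forall>z\<in>K n. real n + 1 + B \<le> Re (Q z)"
      using large[of "(1 / 2) ^ n" n "real n + 1 + B"] by auto
    have "real n + 1 \<le> Re (F z + Q z)" if z: "z \<in> K n" for z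
    proof -
      have "z \<in> cball 0 1" using z K[of n] r(3)[of "Suc n"] by auto
      then have "Re (F z) \<ge> - B" using B[of z] abs_Re_le_cmod[of "F z"] by linarith
      then show ?thesis using Q(3) z by fastforce
    qed
    then show "\<exists>G. holomorphic_several_on G UNIV \<and> P n F G"
      using F Q by (intro exI[of _ "\<lambda>z. F z + Q z"]) (auto simp: P_def intro: holomorphic_several_on_add)
  qed
  then obtain F where F: "\<And>n. holomorphic_several_on (F n) UNIV" "\<And>n. P n (F n) (F (Suc n))" by blast
  define d where "d = (\<lambda>n z. F (Suc n) z - F n z)"
  have db: "norm (d n z) \<le> (1 / 2) ^ n" if "norm z \<le> r m" "m \<le> n" for z m n
    using F(2)[of n] that incseqD[OF r(1) that(2)] by (auto simp: P_def d_def)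
  define f where "f = (\<lambda>z. F 0 z + (\<Sum>n. d n z))"
  have "holomorphic_several_on (\<lambda>z. \<Sum>n. d n z) (ball 0 1)"
  proof (rule holomorphic_several_on_series)
    show "holomorphic_several_on (d n) UNIV" for n
      unfolding d_def by (intro holomorphic_several_on_diff F)
    fix R :: real assume "R < 1"
    then have "\<forall>\<^sub>F n in sequentially. r n > R" using r(2) order_tendstoD by blast
    then obtain N where "r N > R" by (auto simp: eventually_sequentially)
    then show "\<exists>N. \<forall>n\<ge>N. \<forall>z\<in>cball 0 R. norm (d n z) \<le> (1 / 2) ^ n"
      using db[of _ N] by (intro exI[of _ N]) auto
  qed
  then have "holomorphic_several_on f (ball 0 1)"
    unfolding f_def by (intro holomorphic_several_on_add holomorphic_several_on_subset[OF F(1)]) auto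
  moreover have "real n \<le> Re (f z)" if z: "z \<in> K n" for n z
  proof -
    have zr: "norm z \<le> r (Suc n)" using z K[of n] by auto
    have tail: "norm (d (i + Suc n) z) \<le> (1 / 2) ^ (Suc i)" for i
      by (rule order_trans[OF db[OF zr] power_decreasing]) auto
    have geo: "summable (\<lambda>i. (1 / 2 :: real) ^ Suc i)" "(\<Sum>i. (1 / 2 :: real) ^ Suc i) = 1"
      using power_half_series by (auto simp: sums_iff)
    have summ: "summable (\<lambda>i. d (i + Suc n) z)"
      using tail by (intro summable_comparison_test'[OF geo(1)]) auto
    have "(\<Sum>i<Suc n. d i z) = F (Suc n) z - F 0 z" unfolding d_def by (rule sum_lessThan_telescope)
    then have "f z = F (Suc n) z + (\<Sum>i. d (i + Suc n) z)"
      unfolding f_def using suminf_split_initial_segment[of "\<lambda>i. d i z" "Suc n"] summ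
        summable_iff_shift[of "\<lambda>i. d i z" "Suc n"]
      by (simp del: sum.lessThan_Suc)
    moreover have "norm (\<Sum>i. d (i + Suc n) z) \<le> 1"
      using norm_suminf_le[OF tail geo(1)] geo(2) by simp
    then have "Re (\<Sum>i. d (i + Suc n) z) \<ge> - 1"
      using abs_Re_le_cmod[of "\<Sum>i. d (i + Suc n) z"] by linarith
    moreover have "Re (F (Suc n) z) \<ge> real n + 1" using F(2)[of n] z by (auto simp: P_def)
    ultimately show ?thesis by simp
  qed
  ultimately show ?thesis by blast
qed

section \<open>Tangent discs\<close>

definition tangent_disc :: "'a::real_inner \<Rightarrow> real \<Rightarrow> real \<Rightarrow> 'a set"
  where "tangent_disc u s \<rho> = {z. z \<bullet> u = s \<and> norm (z - s *\<^sub>R u) \<le> \<rho>}"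

text \<open>Pythagoras: the offset from the centre of the disc is orthogonal to
  \<open>u\<close>.\<close>

lemma norm_tangent_disc:
  assumes "z \<in> tangent_disc u s \<rho>" "norm u = 1"
  shows "(norm z)\<^sup>2 \<le> s\<^sup>2 + \<rho>\<^sup>2"
proof -
  have uu: "u \<bullet> u = 1" using assms by (simp add: norm_eq_1)
  have "(norm (z - s *\<^sub>R u))\<^sup>2 \<le> \<rho>\<^sup>2"
    using assms by (auto simp: tangent_disc_def intro: power_mono)
  moreover have "(norm (z - s *\<^sub>R u))\<^sup>2 = (norm z)\<^sup>2 - s\<^sup>2"
    using assms uu unfolding tangent_disc_def power2_norm_eq_inner
    by (simp add: inner_diff_left inner_diff_right inner_commute power2_eq_square)
  ultimately show ?thesis by simp
qed

text \<open>For \<open>z\<close> in the disc around \<open>s u'\<close>, the vector \<open>z - s u'\<close> is orthogonal to \<open>u'\<close>, hence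
  \<open>\<langle>z, u\<rangle> \<le> s - s |u - u'|\<^sup>2 / 2 + \<rho> |u - u'|\<close>.\<close>

lemma tangent_discs_separated:
  assumes z: "z \<in> tangent_disc u' s \<rho>" and u: "norm u = 1" "norm u' = 1"
    and sep: "dist u u' \<ge> 5 * \<rho>" and "s \<ge> 1 / 2" "\<rho> > 0"
  shows "z \<bullet> u \<le> s - \<rho>\<^sup>2"
proof -
  have uu: "u \<bullet> u = 1" "u' \<bullet> u' = 1" using u by (simp_all add: norm_eq_1)
  define t where "t = norm (u - u')"
  have t: "t \<ge> 5 * \<rho>" using sep by (simp add: t_def dist_norm)
  have tt: "t\<^sup>2 = 2 - 2 * (u' \<bullet> u)"
    unfolding t_def power2_norm_eq_inner using uu by (simp add: inner_diff_left inner_diff_right inner_commute)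
  have uu': "u' \<bullet> u = 1 - t\<^sup>2 / 2" unfolding tt by (simp add: field_simps)
  have zu': "z \<bullet> u' = s" and zn: "norm (z - s *\<^sub>R u') \<le> \<rho>" using z by (auto simp: tangent_disc_def)
  have "z \<bullet> u = s * (u' \<bullet> u) + (z - s *\<^sub>R u') \<bullet> (u - u')"
    using zu' uu by (simp add: inner_diff_left inner_diff_right inner_commute right_diff_distrib)
  also have "(z - s *\<^sub>R u') \<bullet> (u - u') \<le> norm (z - s *\<^sub>R u') * t"
    unfolding t_def by (rule norm_cauchy_schwarz)
  also have "\<dots> \<le> \<rho> * t" using zn by (intro mult_right_mono) (auto simp: t_def)
  finally have "z \<bullet> u \<le> s - s * t\<^sup>2 / 2 + \<rho> * t" by (simp add: uu' algebra_simps)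
  moreover have "1 / 2 * t\<^sup>2 \<le> s * t\<^sup>2" using assms by (intro mult_right_mono) auto
  moreover have "t\<^sup>2 \<ge> 5 * (\<rho> * t)"
    using mult_right_mono[OF t, of t] by (simp add: power2_eq_square t_def)
  moreover have "\<rho> * t \<ge> 5 * \<rho>\<^sup>2"
    using mult_left_mono[OF t, of \<rho>] \<open>\<rho> > 0\<close> by (simp add: power2_eq_square)
  moreover have "\<rho>\<^sup>2 \<ge> 0" by simp
  ultimately show ?thesis by linarith
qed

text \<open>Each disc gets a step function in \<open>cinner z u\<close> that jumps just inside its
  hyperplane. On any one disc its own step function is near 1 and the others are near 0; on the
  inner ball all are near 0.\<close>

lemma exists_entire_large_on_tangent_discs:
  fixes U :: "(complex ^ 'n::finite) set"
  assumes U: "finite U" "\<And>u. u \<in> U \<Longrightarrow> norm u = 1"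
    and sep: "\<And>u u'. u \<in> U \<Longrightarrow> u' \<in> U \<Longrightarrow> u \<noteq> u' \<Longrightarrow> dist u u' \<ge> 5 * \<rho>"
    and s: "s \<ge> 1 / 2" and \<rho>: "\<rho> > 0" and r: "r < s" and e: "e > 0"
  shows "\<exists>Q. holomorphic_several_on Q UNIV \<and> (\<forall>z\<in>cball 0 r. norm (Q z) \<le> e) \<and>
    (\<forall>u\<in>U. \<forall>z\<in>tangent_disc u s \<rho>. A \<le> Re (Q z))"
proof -
  \<comment> \<open>The jump takes place between the heights \<open>s - 2 * \<eta>\<close> and
    \<open>s\<close>; both the inner ball (gap \<open>s - r\<close>) and the other discs (gap
    \<open>\<rho>^2\<close>) lie below it.\<close>
  define \<eta> where "\<eta> = min (s - r) (\<rho>\<^sup>2) / 2"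
  have \<eta>: "\<eta> > 0" "2 * \<eta> \<le> s - r" "2 * \<eta> \<le> \<rho>\<^sup>2" using r \<rho> by (auto simp: \<eta>_def)
  define X where "X = cball 0 r \<union> (\<Union>u\<in>U. tangent_disc u s \<rho>)"
  have "bounded (tangent_disc u s \<rho>)" for u :: "complex ^ 'n"
    by (rule bounded_subset[OF bounded_cball[of "s *\<^sub>R u" \<rho>]]) (auto simp: tangent_disc_def dist_norm norm_minus_commute)
  then have X: "bounded X" using U by (auto simp: X_def)
  \<comment> \<open>The summand \<open>e\<close> pays for the total error, which \<open>e'\<close>
    keeps below \<open>e\<close>; the \<open>1 +\<close> in \<open>e'\<close> covers an empty
    \<open>U\<close>.\<close>
  define A' where "A' = \<bar>A\<bar> + e"
  have A': "A' > 0" using e by (simp add: A'_def)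
  define e' where "e' = e / (A' * (1 + real (card U)))"
  have e': "e' > 0" using e A' by (simp add: e'_def)
  have "\<exists>q. holomorphic_several_on q UNIV \<and> (\<forall>z\<in>X. z \<bullet> u \<le> s - 2 * \<eta> \<longrightarrow> norm (q z) \<le> e') \<and>
      (\<forall>z\<in>X. z \<bullet> u = s \<longrightarrow> norm (q z - 1) \<le> e')" for u
  proof -
    have "bounded ((\<lambda>z. cinner z u) ` X)" by (rule bounded_linear_image[OF X bounded_linear_cinner])
    then obtain L where L: "\<And>z. z \<in> X \<Longrightarrow> norm (cinner z u) \<le> L" by (auto simp: bounded_iff)
    define L' where "L' = \<bar>L\<bar> + \<bar>s - \<eta>\<bar> + 1"
    have L': "L' > 0" by (simp add: L'_def)
    obtain h where h: "h holomorphic_on UNIV"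
      "\<And>w. norm w \<le> L' \<Longrightarrow> Re w \<le> - \<eta> \<Longrightarrow> norm (h w) < e'"
      "\<And>w. norm w \<le> L' \<Longrightarrow> Re w \<ge> \<eta> \<Longrightarrow> norm (h w - 1) < e'"
      using entire_step_function[OF L' \<eta>(1) e'] by blast
    define q where "q = (\<lambda>z. (h \<circ> (\<lambda>w. w - of_real (s - \<eta>))) (cinner z u))"
    have "(h \<circ> (\<lambda>w. w - of_real (s - \<eta>))) holomorphic_on UNIV"
      by (intro holomorphic_on_compose holomorphic_intros holomorphic_on_subset[OF h(1)]) auto
    then have "holomorphic_several_on q UNIV"
      unfolding q_def by (rule holomorphic_several_on_compose_cinner)
    moreover have "norm (cinner z u - of_real (s - \<eta>)) \<le> L'" if "z \<in> X" for z
      using norm_triangle_ineq4[of "cinner z u" "of_real (s - \<eta>)"] L[OF that]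
      unfolding L'_def norm_of_real by linarith
    ultimately show ?thesis
      using h(2,3) by (intro exI[of _ q] conjI ballI impI) (auto simp: q_def Re_cinner intro!: less_imp_le)
  qed
  then obtain q where q: "\<And>u. holomorphic_several_on (q u) UNIV"
      "\<And>u z. z \<in> X \<Longrightarrow> z \<bullet> u \<le> s - 2 * \<eta> \<Longrightarrow> norm (q u z) \<le> e'"
      "\<And>u z. z \<in> X \<Longrightarrow> z \<bullet> u = s \<Longrightarrow> norm (q u z - 1) \<le> e'" by metis
  define Q where "Q = (\<lambda>z. of_real A' * (\<Sum>u\<in>U. q u z))"
  have small: "A' * (real (card U) * e') \<le> e"
  proof -
    have "real (card U) / (1 + real (card U)) \<le> 1" by simp
    from mult_left_mono[OF this less_imp_le[OF e]]
    have "e * (real (card U) / (1 + real (card U))) \<le> e" by simp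
    then show ?thesis using A' by (simp add: e'_def mult.commute)
  qed
  have "holomorphic_several_on Q UNIV"
    unfolding Q_def by (intro holomorphic_several_on_cmult holomorphic_several_on_sum U q)
  moreover have "norm (Q z) \<le> e" if z: "z \<in> cball 0 r" for z
  proof -
    have "norm (q u z) \<le> e'" if u: "u \<in> U" for u
    proof (rule q(2))
      show "z \<in> X" using z by (simp add: X_def)
      have "z \<bullet> u \<le> norm z" using norm_cauchy_schwarz[of z u] U(2)[OF u] by simp
      then show "z \<bullet> u \<le> s - 2 * \<eta>" using z \<eta>(2) by simp
    qed
    then have "norm (\<Sum>u\<in>U. q u z) \<le> real (card U) * e'" by (rule sum_norm_bound)
    then have "norm (Q z) \<le> A' * (real (card U) * e')"
      using A' by (simp add: Q_def norm_mult mult_left_mono)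
    then show ?thesis using small by linarith
  qed
  moreover have "A \<le> Re (Q z)" if u: "u \<in> U" and z: "z \<in> tangent_disc u s \<rho>" for u z
  proof -
    have zX: "z \<in> X" using u z by (auto simp: X_def)
    have others: "norm (q v z - (if v = u then 1 else 0)) \<le> e'" if v: "v \<in> U" for v
    proof (cases "v = u")
      case True
      then show ?thesis using q(3)[OF zX, of u] z by (simp add: tangent_disc_def)
    next
      case False
      have "z \<bullet> v \<le> s - \<rho>\<^sup>2"
        using tangent_discs_separated[OF z] U(2) u v False sep s \<rho> by blast
      then show ?thesis using q(2)[OF zX, of v] \<eta>(3) False by simp
    qed
    have "(\<Sum>v\<in>U. q v z) - 1 = (\<Sum>v\<in>U. q v z - (if v = u then 1 else 0))"
      using U(1) u by (simp add: sum_subtractf)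
    then have "norm ((\<Sum>v\<in>U. q v z) - 1) \<le> real (card U) * e'"
      using sum_norm_bound[of U, OF others] by simp
    then have "Re (\<Sum>v\<in>U. q v z) \<ge> 1 - real (card U) * e'"
      using abs_Re_le_cmod[of "(\<Sum>v\<in>U. q v z) - 1"] by simp
    then have "A' * Re (\<Sum>v\<in>U. q v z) \<ge> A' * (1 - real (card U) * e')"
      using A' by (intro mult_left_mono) auto
    then have "Re (Q z) \<ge> A' - A' * (real (card U) * e')" by (simp add: Q_def right_diff_distrib)
    then show ?thesis using small by (simp add: A'_def)
  qed
  ultimately show ?thesis by blast
qed

text \<open>The sphere is cut into the cells of a cubic grid, coloured by their coordinates modulo a
  constant \<open>k\<close>. Distinct cells of the same colour are far apart relative to their size, and the
  number of colours does not depend on the mesh.\<close>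

lemma sphere_covered_by_separated_families:
  "\<exists>m>0::nat. \<forall>\<rho>>0. \<exists>U :: nat \<Rightarrow> 'a::euclidean_space set.
     (\<forall>j. finite (U j) \<and> (\<forall>u\<in>U j. norm u = 1) \<and>
       (\<forall>u\<in>U j. \<forall>u'\<in>U j. u \<noteq> u' \<longrightarrow> 5 * \<rho> \<le> dist u u')) \<and>
     (\<forall>x. norm x = 1 \<longrightarrow> (\<exists>j<m. \<exists>u\<in>U j. dist x u \<le> \<rho> / 4))"
proof -
  \<comment> \<open>Cells of equal colour differ by at least \<open>k\<close> in some coordinate,
    hence their points by at least
    \<open>(k - 1) * h = 20 * DIM('a) * h = 5 * \<rho>\<close>.\<close>
  define k :: int where "k = 20 * int DIM('a) + 1"
  define C :: "('a \<Rightarrow> int) set" where "C = (\<Pi>\<^sub>E b\<in>Basis. {0..<k})"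
  have k: "k > 0" by (simp add: k_def)
  have C: "finite C" unfolding C_def by (intro finite_PiE) auto
  obtain e where e: "bij_betw e {0..<card C} C"
    using ex_bij_betw_nat_finite[OF C] by blast
  have "(\<lambda>b\<in>Basis. 0) \<in> C" using k by (auto simp: C_def)
  then have m: "card C > 0" using C card_gt_0_iff by blast
  show ?thesis
  proof (intro exI[of _ "card C"] conjI m allI impI)
    fix \<rho> :: real assume \<rho>: "\<rho> > 0"
    \<comment> \<open>The sum of the coordinate differences within a cell is at most
      \<open>DIM('a) * h = \<rho> / 4\<close>.\<close>
    define h where "h = \<rho> / (4 * DIM('a))"
    have h: "h > 0" using \<rho> by (simp add: h_def)
    have Dh: "DIM('a) * h = \<rho> / 4" by (simp add: h_def)
    define cell :: "'a \<Rightarrow> 'a \<Rightarrow> int" where "cell x = (\<lambda>b\<in>Basis. \<lfloor>(x \<bullet> b) / h\<rfloor>)" for x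
    define S :: "'a set" where "S = {x. norm x = 1}"
    define pick where "pick g = (SOME x. x \<in> S \<and> cell x = g)" for g
    have pick: "pick g \<in> S" "cell (pick g) = g" if "g \<in> cell ` S" for g
      using someI_ex[of "\<lambda>x. x \<in> S \<and> cell x = g"] that unfolding pick_def by auto
    define U where "U j = pick ` {g \<in> cell ` S. (\<lambda>b\<in>Basis. g b mod k) = e j}" for j
    have "cell ` S \<subseteq> (\<Pi>\<^sub>E b\<in>Basis. {\<lfloor>- 1 / h\<rfloor>..\<lfloor>1 / h\<rfloor>})"
    proof (clarify, intro PiE_I)
      fix x b :: 'a assume x: "x \<in> S" and b: "b \<in> Basis"
      have "\<bar>x \<bullet> b\<bar> \<le> 1" using Basis_le_norm[OF b, of x] x by (simp add: S_def)
      then have "- 1 / h \<le> (x \<bullet> b) / h" "(x \<bullet> b) / h \<le> 1 / h"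
        using h by (simp_all add: divide_right_mono abs_le_iff del: divide_minus_left)
      then show "cell x b \<in> {\<lfloor>- 1 / h\<rfloor>..\<lfloor>1 / h\<rfloor>}" using b by (auto simp: cell_def intro: floor_mono)
    qed (auto simp: cell_def)
    then have fin: "finite (cell ` S)" by (rule finite_subset) (auto intro: finite_PiE)
    show "\<exists>U. (\<forall>j. finite (U j) \<and> (\<forall>u\<in>U j. norm u = 1) \<and>
         (\<forall>u\<in>U j. \<forall>u'\<in>U j. u \<noteq> u' \<longrightarrow> 5 * \<rho> \<le> dist u u')) \<and>
       (\<forall>x::'a. norm x = 1 \<longrightarrow> (\<exists>j<card C. \<exists>u\<in>U j. dist x u \<le> \<rho> / 4))"
    proof (intro exI[of _ U] conjI allI ballI impI)
      show "finite (U j)" for j using fin by (simp add: U_def)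
      show "norm u = 1" if "u \<in> U j" for u j using that pick by (auto simp: U_def S_def)
    next
      fix j u u' assume "u \<in> U j" "u' \<in> U j" "u \<noteq> u'"
      then obtain g g' where g: "g \<in> cell ` S" "g' \<in> cell ` S" "u = pick g" "u' = pick g'" "g \<noteq> g'"
        and col: "(\<lambda>b\<in>Basis. g b mod k) = (\<lambda>b\<in>Basis. g' b mod k)"
        unfolding U_def by (smt (verit) imageE mem_Collect_eq)
      have cells: "cell u = g" "cell u' = g'" using g pick by auto
      obtain b where b: "b \<in> Basis" "g b \<noteq> g' b"
        using g(5) cells by (metis (no_types, lifting) cell_def restrict_ext restrict_restrict Int_absorb restrict_apply')
      have "g b mod k = g' b mod k" using fun_cong[OF col, of b] b(1) by simp
      then have "k dvd g b - g' b" by (simp add: mod_eq_dvd_iff)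
      then have "k \<le> \<bar>g b - g' b\<bar>" using b(2) by (metis dvd_abs_iff zdvd_imp_le zero_less_abs_iff right_minus_eq)
      moreover have "g b = \<lfloor>(u \<bullet> b) / h\<rfloor>" "g' b = \<lfloor>(u' \<bullet> b) / h\<rfloor>"
        using cells b(1) by (auto simp: cell_def)
      ultimately have "real_of_int k - 1 \<le> \<bar>(u \<bullet> b) / h - (u' \<bullet> b) / h\<bar>" by linarith
      also have "\<dots> = \<bar>(u - u') \<bullet> b\<bar> / h" using h by (simp add: inner_diff_left diff_divide_distrib[symmetric])
      also have "\<dots> \<le> norm (u - u') / h" using h b by (intro divide_right_mono Basis_le_norm) auto
      finally have "20 * (DIM('a) * h) \<le> dist u u'" using h by (simp add: k_def dist_norm field_simps)
      then show "5 * \<rho> \<le> dist u u'" by (simp add: Dh)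
    next
      fix x :: 'a assume x: "norm x = 1"
      define u where "u = pick (cell x)"
      have cx: "cell x \<in> cell ` S" using x by (simp add: S_def)
      have "(\<lambda>b\<in>Basis. cell x b mod k) \<in> C" using k by (auto simp: C_def)
      then have "(\<lambda>b\<in>Basis. cell x b mod k) \<in> e ` {0..<card C}"
        using bij_betw_imp_surj_on[OF e] by simp
      then obtain j where ej: "(\<lambda>b\<in>Basis. cell x b mod k) = e j" and "j \<in> {0..<card C}"
        by (rule imageE)
      then have j: "j < card C" by simp
      have "u \<in> U j" unfolding U_def u_def by (intro imageI CollectI conjI cx ej)
      moreover have "dist x u \<le> \<rho> / 4"
      proof -
        have "\<bar>(x - u) \<bullet> b\<bar> \<le> h" if b: "b \<in> Basis" for b
        proof -
          have "cell x b = cell u b" using pick(2)[OF cx] by (simp add: u_def)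
          then have "\<lfloor>(x \<bullet> b) / h\<rfloor> = \<lfloor>(u \<bullet> b) / h\<rfloor>" using b by (simp add: cell_def)
          then have "\<bar>(x \<bullet> b) / h - (u \<bullet> b) / h\<bar> \<le> 1" by linarith
          then have "\<bar>(x - u) \<bullet> b\<bar> / h \<le> 1"
            using h by (simp add: inner_diff_left diff_divide_distrib[symmetric])
          then show ?thesis using h by (simp add: field_simps)
        qed
        then have "(\<Sum>b\<in>Basis. \<bar>(x - u) \<bullet> b\<bar>) \<le> DIM('a) * h" by (rule sum_bounded_above)
        then show ?thesis using norm_le_l1[of "x - u"] by (simp add: Dh dist_norm)
      qed
      ultimately show "\<exists>j<card C. \<exists>u\<in>U j. dist x u \<le> \<rho> / 4" using j by blast
    qed
  qed
qed

section \<open>Paths that avoid the discs\<close>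

lemma finite_length_bounded_sums:
  assumes "finite_length p"
  obtains B where "\<And>x n. strict_mono x \<Longrightarrow> (\<And>i. 0 < x i \<and> x i < 1) \<Longrightarrow>
    (\<Sum>i<(n::nat). dist (p (x i)) (p (x (Suc i)))) \<le> B"
proof -
  obtain B where B: "\<And>n t. t 0 = 0 \<Longrightarrow> t n = 1 \<Longrightarrow> strict_mono_on {..n} t \<Longrightarrow>
      (\<Sum>i<n. dist (p (t i)) (p (t (Suc i)))) \<le> B"
    using assms unfolding finite_length_def bdd_above_def by blast
  show thesis
  proof
    fix x :: "nat \<Rightarrow> real" and n :: nat
    assume x: "strict_mono x" "\<And>i. 0 < x i \<and> x i < 1"
    \<comment> \<open>Admissible partitions run from 0 to 1, so the points
      \<open>x 0, ..., x n\<close> are padded by these ends; the two extra summands are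
      nonnegative.\<close>
    define t where "t = (\<lambda>i. if i = 0 then 0 else if i \<le> Suc n then x (i - 1) else 1)"
    let ?d = "\<lambda>i. dist (p (t i)) (p (t (Suc i)))"
    have "(\<Sum>i<n. dist (p (x i)) (p (x (Suc i)))) = (\<Sum>i<n. ?d (Suc i))"
      by (intro sum.cong) (auto simp: t_def)
    also have "\<dots> \<le> (\<Sum>i<Suc n. ?d i)" unfolding sum.lessThan_Suc_shift by simp
    also have "\<dots> \<le> (\<Sum>i<Suc (Suc n). ?d i)" by simp
    also have "\<dots> \<le> B"
    proof (rule B)
      show "strict_mono_on {..Suc (Suc n)} t"
      proof (rule strict_mono_onI)
        fix i j assume "i \<in> {..Suc (Suc n)}" "j \<in> {..Suc (Suc n)}" "i < j"
        then show "t i < t j" using x strict_monoD[OF x(1), of "i - 1" "j - 1"] by (auto simp: t_def)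
      qed
    qed (auto simp: t_def)
    finally show "(\<Sum>i<n. dist (p (x i)) (p (x (Suc i)))) \<le> B" .
  qed
qed

text \<open>The height \<open>p t \<bullet> u\<close> passes from at most \<open>s\<close> to at
  least \<open>s\<close>, so the path meets the hyperplane; having hardly moved sideways, it does so
  inside the disc.\<close>

lemma path_hits_tangent_disc:
  fixes p :: "real \<Rightarrow> 'a::real_inner"
  assumes p: "continuous_on {\<alpha>..\<beta>} p" and "\<alpha> \<le> \<beta>"
    and a: "norm (p \<alpha>) \<le> s" and b: "s \<le> norm (p \<beta>)" "s\<^sup>2 + \<rho>\<^sup>2 \<le> (norm (p \<beta>))\<^sup>2"
    and u: "norm u = 1" "dist (p \<alpha>) (norm (p \<alpha>) *\<^sub>R u) \<le> \<rho> / 4"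
    and near: "\<And>t. t \<in> {\<alpha>..\<beta>} \<Longrightarrow> dist (p t) (p \<alpha>) \<le> \<rho> / 4"
  obtains t where "t \<in> {\<alpha>..\<beta>}" "p t \<in> tangent_disc u s \<rho>"
proof -
  let ?a = "norm (p \<alpha>)" and ?b = "norm (p \<beta>)"
  have uu: "u \<bullet> u = 1" using u by (simp add: norm_eq_1)
  have s: "s \<ge> 0" using a norm_ge_zero order_trans by blast
  have ba: "?b - ?a \<le> \<rho> / 4"
    using near[of \<beta>] \<open>\<alpha> \<le> \<beta>\<close> norm_triangle_ineq2[of "p \<beta>" "p \<alpha>"] by (simp add: dist_norm)
  \<comment> \<open>Three displacements of at most \<open>\<rho> / 4\<close> each: along the path,
    from \<open>p \<alpha>\<close> to the ray through \<open>u\<close>, and along that ray.\<close>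
  have close: "norm (p t - c *\<^sub>R u) \<le> 3 / 4 * \<rho>" if t: "t \<in> {\<alpha>..\<beta>}" and c: "?a \<le> c" "c \<le> ?b" for t c
  proof -
    have "p t - c *\<^sub>R u = (p t - p \<alpha>) + (p \<alpha> - ?a *\<^sub>R u) + (?a - c) *\<^sub>R u"
      by (simp add: scaleR_diff_left)
    also have "norm \<dots> \<le> norm (p t - p \<alpha>) + norm (p \<alpha> - ?a *\<^sub>R u) + norm ((?a - c) *\<^sub>R u)"
      by (rule order_trans[OF norm_triangle_ineq add_right_mono[OF norm_triangle_ineq]])
    also have "norm ((?a - c) *\<^sub>R u) = \<bar>?a - c\<bar>" using u by simp
    finally show ?thesis using near[OF t] u(2) c ba by (simp add: dist_norm)
  qed
  have "p \<alpha> \<bullet> u \<le> s" using norm_cauchy_schwarz[of "p \<alpha>" u] u a by simp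
  moreover have "s \<le> p \<beta> \<bullet> u"
  proof -
    \<comment> \<open>Expanding the square gives
      \<open>?b^2 + s^2 \<le> 2 * ?b * (p \<beta> \<bullet> u)\<close>, and the left side is at
      least \<open>2 * ?b * s\<close>.\<close>
    have "(norm (p \<beta> - ?b *\<^sub>R u))\<^sup>2 \<le> (3 / 4 * \<rho>)\<^sup>2"
      using close[of \<beta> ?b] \<open>\<alpha> \<le> \<beta>\<close> a b by (intro power_mono) auto
    also have "\<dots> \<le> \<rho>\<^sup>2" by (simp add: power_mult_distrib power2_eq_square)
    also have "\<dots> \<le> ?b\<^sup>2 - s\<^sup>2" using b by simp
    finally have "(norm (p \<beta> - ?b *\<^sub>R u))\<^sup>2 \<le> ?b\<^sup>2 - s\<^sup>2" .
    moreover have "(norm (p \<beta> - ?b *\<^sub>R u))\<^sup>2 = 2 * ?b\<^sup>2 - 2 * ?b * (p \<beta> \<bullet> u)"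
      unfolding power2_norm_eq_inner using uu power2_norm_eq_inner[of "p \<beta>"]
      by (simp add: inner_diff_left inner_diff_right inner_commute power2_eq_square algebra_simps)
    moreover have "2 * ?b * s \<le> ?b\<^sup>2 + s\<^sup>2" by (rule sum_squares_bound)
    ultimately have "2 * ?b * s \<le> 2 * ?b * (p \<beta> \<bullet> u)" by linarith
    then show ?thesis
    proof (cases "?b = 0")
      case True
      then show ?thesis using b(1) s by simp
    next
      case False
      then have "2 * ?b > 0" by simp
      with \<open>2 * ?b * s \<le> 2 * ?b * (p \<beta> \<bullet> u)\<close> show ?thesis by (rule mult_left_le_imp_le)
    qed
  qed
  moreover have "continuous_on {\<alpha>..\<beta>} (\<lambda>t. p t \<bullet> u)" by (intro continuous_intros p)
  ultimately obtain t where t: "\<alpha> \<le> t" "t \<le> \<beta>" "p t \<bullet> u = s"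
    using IVT'[of "\<lambda>t. p t \<bullet> u" \<alpha> s \<beta>] \<open>\<alpha> \<le> \<beta>\<close> by blast
  have "norm (p t - s *\<^sub>R u) \<le> 3 / 4 * \<rho>" using t a b by (intro close) auto
  moreover have "\<rho> \<ge> 0" using near[of \<alpha>] \<open>\<alpha> \<le> \<beta>\<close> by simp
  ultimately have "p t \<in> tangent_disc u s \<rho>" using t by (simp add: tangent_disc_def)
  then show thesis using that t by auto
qed

text \<open>Alternating \<open>T\<close> and \<open>T'\<close> yields one increasing sequence of
  times; the sum in question keeps every second term of its polygon length.\<close>

lemma interlaced_sums_bounded:
  assumes p: "finite_length p" and T: "\<And>i. 0 < T i" "\<And>i. T i < T' i" "\<And>i. T' i < T (Suc i)" "\<And>i. T i < 1"
  obtains B where "\<And>n. (\<Sum>i<n. dist (p (T i)) (p (T' i))) \<le> B"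
proof -
  obtain B where B: "\<And>x n. strict_mono x \<Longrightarrow> (\<And>i. 0 < x i \<and> x i < 1) \<Longrightarrow>
    (\<Sum>i<(n::nat). dist (p (x i)) (p (x (Suc i)))) \<le> B"
    using finite_length_bounded_sums[OF p] by blast
  define x where "x = (\<lambda>n. if even n then T (n div 2) else T' (n div 2))"
  have x: "x (2 * i) = T i" "x (Suc (2 * i)) = T' i" "x (Suc (Suc (2 * i))) = T (Suc i)" for i
    by (auto simp: x_def)
  have "x n < x (Suc n)" for n
    by (cases "even n") (auto simp: x T elim!: evenE oddE)
  then have "strict_mono x" by (simp add: strict_mono_Suc_iff)
  moreover have "0 < x i \<and> x i < 1" for i
    using T less_trans[OF T(1,2)] less_trans[OF T(3,4)] by (auto simp: x_def)
  ultimately have le: "(\<Sum>i<2 * n. dist (p (x i)) (p (x (Suc i)))) \<le> B" for n using B by blast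
  have "(\<Sum>i<n. dist (p (T i)) (p (T' i))) \<le> (\<Sum>i<2 * n. dist (p (x i)) (p (x (Suc i))))" for n
    by (induction n) (auto simp: x intro: add_mono order_trans)
  then show thesis using le that order_trans by blast
qed

section \<open>The labyrinth\<close>

text \<open>The discs at level \<open>n\<close> are tangent to the sphere of radius \<open>level_radius n\<close>. The radii
  \<open>separating_radius n\<close> interlace with these and bound the balls on which the correction at level
  \<open>n\<close> has to be small.\<close>

definition level_radius :: "nat \<Rightarrow> real"
  where "level_radius n = sqrt (1 - 1 / (real n + 2))"

definition separating_radius :: "nat \<Rightarrow> real"
  where "separating_radius n = sqrt (1 - 2 / (2 * real n + 3))"

lemma level_radius_squared: "(level_radius n)\<^sup>2 = 1 - 1 / (real n + 2)"
  by (simp add: level_radius_def)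

lemma separating_radius_squared: "(separating_radius n)\<^sup>2 = 1 - 2 / (2 * real n + 3)"
  by (simp add: separating_radius_def)

lemma level_radius_ge_half: "level_radius n \<ge> 1 / 2"
proof -
  have "(1 / 2)\<^sup>2 \<le> 1 - 1 / (real n + 2)" by (simp add: field_simps power2_eq_square)
  then show ?thesis unfolding level_radius_def by (rule real_le_rsqrt)
qed

lemma level_radius_less_1: "level_radius n < 1"
  by (simp add: level_radius_def)

lemma strict_mono_level_radius: "strict_mono level_radius"
  unfolding strict_mono_Suc_iff level_radius_def by (simp add: field_simps)

lemma level_radius_tendsto_1: "level_radius \<longlonglongrightarrow> 1"
  unfolding level_radius_def by real_asymp

lemma incseq_separating_radius: "incseq separating_radius"
  unfolding incseq_Suc_iff separating_radius_def by (simp add: field_simps)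

lemma separating_radius_tendsto_1: "separating_radius \<longlonglongrightarrow> 1"
  unfolding separating_radius_def by real_asymp

lemma separating_radius_less_level_radius: "separating_radius n < level_radius n"
  unfolding separating_radius_def level_radius_def by (simp add: field_simps)

text \<open>The gap of the squared radii is \<open>1 / ((n + 2) * (2 * n + 5))\<close>. Being of
  order \<open>1 / n^2\<close>, it leaves room for \<open>\<rho>\<close> of order
  \<open>1 / n\<close>, which is what makes the sideways movements sum to infinity.\<close>

lemma level_radius_gap:
  assumes "0 \<le> \<rho>" "\<rho> \<le> 1 / (2 * (real n + 3))"
  shows "(level_radius n)\<^sup>2 + \<rho>\<^sup>2 \<le> (separating_radius (Suc n))\<^sup>2"
    and "(level_radius n)\<^sup>2 + \<rho>\<^sup>2 \<le> (level_radius (Suc n))\<^sup>2"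
proof -
  have "\<rho>\<^sup>2 \<le> (1 / (2 * (real n + 3)))\<^sup>2" using assms by (intro power_mono) auto
  also have "\<dots> \<le> 1 / (real n + 2) - 2 / (2 * real n + 5)"
    by (simp add: divide_simps power2_eq_square) (simp add: algebra_simps)
  finally have *: "\<rho>\<^sup>2 \<le> 1 / (real n + 2) - 2 / (2 * real n + 5)" .
  then show "(level_radius n)\<^sup>2 + \<rho>\<^sup>2 \<le> (separating_radius (Suc n))\<^sup>2"
    by (simp add: level_radius_squared separating_radius_squared add.commute)
  also have "\<dots> \<le> (level_radius (Suc n))\<^sup>2"
    using separating_radius_less_level_radius[of "Suc n"]
    by (intro power_mono) (auto simp: separating_radius_def)
  finally show "(level_radius n)\<^sup>2 + \<rho>\<^sup>2 \<le> (level_radius (Suc n))\<^sup>2" .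
qed

theorem theorem1p1:
  assumes "CARD('n::finite) \<ge> 2"
  shows "\<exists>f :: complex ^ 'n \<Rightarrow> complex. holomorphic_several_on f (ball 0 1) \<and>
    (\<forall>p :: real \<Rightarrow> complex ^ 'n.
       path p \<and> path_image p \<subseteq> cball 0 1 \<and> finite_length p \<and>
       (\<forall>t\<in>{0..<1}. norm (p t) < 1) \<and> norm (p 1) = 1 \<longrightarrow>
       \<not> bounded ((\<lambda>t. Re (f (p t))) ` {0..<1}))"
proof -
  define separated where "separated r U \<longleftrightarrow> (\<forall>j. finite (U j) \<and> (\<forall>u\<in>U j. norm u = 1) \<and>
      (\<forall>u\<in>U j. \<forall>u'\<in>U j. u \<noteq> u' \<longrightarrow> 5 * r \<le> dist u u'))"
    for r and U :: "nat \<Rightarrow> (complex ^ 'n) set"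
  define covers where "covers r m U \<longleftrightarrow> (\<forall>x. norm x = 1 \<longrightarrow> (\<exists>j<m. \<exists>u\<in>U j. dist x u \<le> r / 4))"
    for r and m :: nat and U :: "nat \<Rightarrow> (complex ^ 'n) set"
  obtain m :: nat where m: "m > 0" and families: "\<And>r. r > 0 \<Longrightarrow> \<exists>U. separated r U \<and> covers r m U"
    using sphere_covered_by_separated_families[where 'a = "complex ^ 'n"]
    unfolding separated_def covers_def by blast
  \<comment> \<open>A level \<open>n\<close> of block \<open>k\<close> satisfies
    \<open>n + 3 \<le> (m + 3) * (k + 1)\<close>, so \<open>level_radius_gap\<close> applies with
    this radius throughout the block.\<close>
  define \<rho> where "\<rho> k = 1 / (2 * (real m + 3) * (real k + 1))" for k :: nat
  have \<rho>_pos: "\<rho> k > 0" for k by (simp add: \<rho>_def)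
  obtain U where sep: "\<And>k. separated (\<rho> k) (U k)" and cov: "\<And>k. covers (\<rho> k) m (U k)"
    using families[OF \<rho>_pos] by metis
  have U: "finite (U k j)" "u \<in> U k j \<Longrightarrow> norm u = 1"
    "u \<in> U k j \<Longrightarrow> u' \<in> U k j \<Longrightarrow> u \<noteq> u' \<Longrightarrow> 5 * \<rho> k \<le> dist u u'" for k j u u'
    using sep[of k] unfolding separated_def by blast+
  \<comment> \<open>Block \<open>k\<close> consists of the levels
    \<open>m * k, ..., m * k + m - 1\<close>, one for each colour of its covering family.\<close>
  define K where "K n = (\<Union>u\<in>U (n div m) (n mod m). tangent_disc u (level_radius n) (\<rho> (n div m)))" for n
  have \<rho>_le: "\<rho> (n div m) \<le> 1 / (2 * (real n + 3))" for n
  proof -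
    have "n < m * (n div m) + m" using m by (metis add_strict_left_mono mod_less_divisor mult_div_mod_eq)
    then have "n + 3 \<le> (m + 3) * (n div m + 1)" by (simp add: algebra_simps)
    then have "real (n + 3) \<le> real ((m + 3) * (n div m + 1))" by (simp only: of_nat_le_iff)
    then have "real n + 3 \<le> (real m + 3) * (real (n div m) + 1)" by (simp only: of_nat_simps of_nat_numeral)
    then have "2 * (real n + 3) \<le> 2 * (real m + 3) * (real (n div m) + 1)"
      unfolding mult.assoc by (rule mult_left_mono) simp
    then show ?thesis unfolding \<rho>_def by (rule divide_left_mono) simp_all
  qed
  have "\<exists>f. holomorphic_several_on f (ball 0 1) \<and> (\<forall>n. \<forall>z\<in>K n. real n \<le> Re (f z))"
  proof (rule exists_holomorphic_large_on)
    show "incseq separating_radius" "separating_radius \<longlonglongrightarrow> 1"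
      by (rule incseq_separating_radius separating_radius_tendsto_1)+
    show "separating_radius n < 1" for n
      using separating_radius_less_level_radius level_radius_less_1 less_trans by blast
    show "K n \<subseteq> cball 0 (separating_radius (Suc n))" for n
    proof
      fix z assume "z \<in> K n"
      then obtain u where u: "u \<in> U (n div m) (n mod m)" "z \<in> tangent_disc u (level_radius n) (\<rho> (n div m))"
        by (auto simp: K_def)
      have "(norm z)\<^sup>2 \<le> (separating_radius (Suc n))\<^sup>2"
        using norm_tangent_disc[OF u(2) U(2)[OF u(1)]] level_radius_gap(1)[OF less_imp_le[OF \<rho>_pos] \<rho>_le]
        by (rule order_trans)
      then show "z \<in> cball 0 (separating_radius (Suc n))"
        by (auto intro: power2_le_imp_le simp: separating_radius_def)
    qed
    show "\<exists>Q. holomorphic_several_on Q UNIV \<and> (\<forall>z\<in>cball 0 (separating_radius n). norm (Q z) \<le> e) \<and>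
        (\<forall>z\<in>K n. A \<le> Re (Q z))" if "e > 0" for n A e
    proof -
      have "\<exists>Q. holomorphic_several_on Q UNIV \<and> (\<forall>z\<in>cball 0 (separating_radius n). norm (Q z) \<le> e) \<and>
          (\<forall>u\<in>U (n div m) (n mod m). \<forall>z\<in>tangent_disc u (level_radius n) (\<rho> (n div m)). A \<le> Re (Q z))"
        by (rule exists_entire_large_on_tangent_discs[OF U level_radius_ge_half \<rho>_pos
              separating_radius_less_level_radius that])
      then show ?thesis unfolding K_def by (simp only: ball_UN)
    qed
  qed
  then obtain f where f: "holomorphic_several_on f (ball 0 1)" "\<And>n z. z \<in> K n \<Longrightarrow> real n \<le> Re (f z)"
    by blast
  have "\<not> bounded ((\<lambda>t. Re (f (p t))) ` {0..<1})"
    if path: "path p" and len: "finite_length p"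
      and inside: "\<And>t. t \<in> {0..<1} \<Longrightarrow> norm (p t) < 1" and p1: "norm (p 1) = 1"
    for p :: "real \<Rightarrow> complex ^ 'n"
  proof
    assume "bounded ((\<lambda>t. Re (f (p t))) ` {0..<1})"
    then obtain B where B: "\<And>t. t \<in> {0..<1} \<Longrightarrow> \<bar>Re (f (p t))\<bar> \<le> B"
      unfolding bounded_iff by (metis imageI real_norm_def)
    obtain n0 :: nat where n0: "real n0 > B" using reals_Archimedean2 by blast
    have miss: "p t \<notin> K n" if "n \<ge> n0" "t \<in> {0..<1}" for n t
    proof
      assume "p t \<in> K n"
      then have "real n \<le> B" using f(2) B[OF that(2)] by fastforce
      then show False using n0 that(1) by simp
    qed
    have cont: "continuous_on {0..1} p" using path by (simp add: path_def)
    have "norm (p 0) < 1" using inside[of 0] by simp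
    then have "\<forall>\<^sub>F n in sequentially. norm (p 0) < level_radius n"
      using level_radius_tendsto_1 order_tendstoD by blast
    then obtain n1 where n1: "\<And>n. n \<ge> n1 \<Longrightarrow> norm (p 0) < level_radius n"
      by (auto simp: eventually_sequentially)
    \<comment> \<open>From block \<open>k0\<close> on, the path misses all discs (\<open>n0\<close>)
      and starts inside all levels (\<open>n1\<close>); \<open>a i\<close> is the innermost radius
      of block \<open>k0 + i\<close>.\<close>
    define k0 where "k0 = max n0 n1"
    define a where "a i = level_radius (m * (k0 + i))" for i
    have mk: "k \<le> m * k" for k using m by simp
    have exceed: "\<exists>t'. \<tau> < t' \<and> t' < 1 \<and> norm (p t') = a i"
      if \<tau>: "\<tau> \<in> {0..<1}" "norm (p \<tau>) < a i" for \<tau> i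
    proof -
      have "continuous_on {\<tau>..1} (\<lambda>t. norm (p t))"
        using \<tau> by (intro continuous_intros continuous_on_subset[OF cont]) auto
      moreover have "a i \<le> norm (p 1)" using p1 level_radius_less_1 by (simp add: a_def less_imp_le)
      ultimately obtain t where t: "\<tau> \<le> t" "t \<le> 1" "norm (p t) = a i"
        using IVT'[of "\<lambda>t. norm (p t)" \<tau> "a i" 1] \<tau> by auto
      have "t \<noteq> \<tau>" using t \<tau> by auto
      moreover have "t \<noteq> 1" using t(3) p1 level_radius_less_1[of "m * (k0 + i)"] by (auto simp: a_def)
      ultimately show ?thesis using t by (intro exI[of _ t]) auto
    qed
    have a_mono: "a i < a (Suc i)" for i
      unfolding a_def using m by (intro strict_monoD[OF strict_mono_level_radius]) simp
    \<comment> \<open>Increasing times at which the path lies on the innermost spheres of successive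
      blocks.\<close>
    have "\<exists>T. \<forall>i. (0 < T i \<and> T i < 1 \<and> norm (p (T i)) = a i) \<and> T i < T (Suc i)"
    proof (rule dependent_nat_choice)
      have "norm (p 0) < a 0" unfolding a_def using mk[of k0] by (intro n1) (auto simp: k0_def)
      then show "\<exists>t. 0 < t \<and> t < 1 \<and> norm (p t) = a 0" using exceed[of 0 0] by simp
      show "\<exists>t'. (0 < t' \<and> t' < 1 \<and> norm (p t') = a (Suc i)) \<and> t < t'"
        if "0 < t \<and> t < 1 \<and> norm (p t) = a i" for t i
      proof -
        have "\<exists>t'. t < t' \<and> t' < 1 \<and> norm (p t') = a (Suc i)"
          using that a_mono[of i] by (intro exceed) auto
        then show ?thesis using that less_trans by blast
      qed
    qed
    then obtain T where T: "\<And>i. 0 < T i" "\<And>i. T i < 1" "\<And>i. norm (p (T i)) = a i"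
        "\<And>i. T i < T (Suc i)" by blast
    \<comment> \<open>The heart of the argument: a path that stays within \<open>\<rho> / 4\<close>
      of \<open>p (T i)\<close> while crossing the block would hit the disc of a colour whose centre
      covers the direction of \<open>p (T i)\<close>. The strict inequalities for \<open>t\<close>
      allow interlacing.\<close>
    have "\<exists>t. T i < t \<and> t < T (Suc i) \<and> \<rho> (k0 + i) / 4 \<le> dist (p (T i)) (p t)" for i
    proof (rule ccontr)
      let ?k = "k0 + i"
      assume "\<nexists>t. T i < t \<and> t < T (Suc i) \<and> \<rho> ?k / 4 \<le> dist (p (T i)) (p t)"
      then have small: "dist (p t) (p (T i)) \<le> \<rho> ?k / 4" if "t \<in> {T i<..<T (Suc i)}" for t
        using that by (force simp: dist_commute)
      have contT: "continuous_on {T i..T (Suc i)} p"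
        using T(1)[of i] T(2)[of "Suc i"] by (intro continuous_on_subset[OF cont]) auto
      have clos: "closure {T i<..<T (Suc i)} = {T i..T (Suc i)}" using T(4)[of i] by simp
      have near: "dist (p t) (p (T i)) \<le> \<rho> ?k / 4" if "t \<in> {T i..T (Suc i)}" for t
        by (rule continuous_le_on_closure[of "{T i<..<T (Suc i)}" "\<lambda>t. dist (p t) (p (T i))"])
          (use that small contT clos in \<open>auto intro!: continuous_intros\<close>)
      have a: "a i > 0" "a i \<le> 1"
        using level_radius_ge_half[of "m * ?k"] level_radius_less_1[of "m * ?k"] by (auto simp: a_def)
      have "norm (p (T i) /\<^sub>R a i) = 1" using T(3)[of i] a by simp
      then obtain j u where j: "j < m" and u: "u \<in> U ?k j" "dist (p (T i) /\<^sub>R a i) u \<le> \<rho> ?k / 4"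
        using cov[of ?k] unfolding covers_def by blast
      define n where "n = m * ?k + j"
      have n: "n div m = ?k" "n mod m = j" using j by (auto simp: n_def)
      have u1: "norm u = 1" using U(2) u(1) .
      \<comment> \<open>The covering estimate on the unit sphere, scaled by
        \<open>a i \<le> 1\<close>.\<close>
      have close: "dist (p (T i)) (norm (p (T i)) *\<^sub>R u) \<le> \<rho> ?k / 4"
      proof -
        have "p (T i) - a i *\<^sub>R u = a i *\<^sub>R (p (T i) /\<^sub>R a i - u)" using a by (simp add: scaleR_diff_right)
        then have "dist (p (T i)) (a i *\<^sub>R u) = a i * dist (p (T i) /\<^sub>R a i) u"
          using a by (simp add: dist_norm)
        also have "\<dots> \<le> 1 * (\<rho> ?k / 4)" using a u(2) by (intro mult_mono) auto
        finally show ?thesis using T(3) by simp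
      qed
      \<comment> \<open>Since \<open>j < m\<close>, level \<open>Suc n\<close> is at most the first
        level of the next block, so the path gets far enough beyond level \<open>n\<close> for
        \<open>path_hits_tangent_disc\<close>.\<close>
      have "level_radius (Suc n) \<le> a (Suc i)"
        unfolding a_def using j
        by (intro monoD[OF strict_mono_mono[OF strict_mono_level_radius]]) (simp add: n_def)
      then have b: "level_radius (Suc n) \<le> norm (p (T (Suc i)))" using T(3) by simp
      have "level_radius n \<le> level_radius (Suc n)"
        by (intro monoD[OF strict_mono_mono[OF strict_mono_level_radius]]) simp
      then have b1: "level_radius n \<le> norm (p (T (Suc i)))" using b by simp
      have b2: "(level_radius n)\<^sup>2 + (\<rho> ?k)\<^sup>2 \<le> (norm (p (T (Suc i))))\<^sup>2"
      proof -
        have "0 \<le> level_radius (Suc n)" using level_radius_ge_half[of "Suc n"] by simp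
        then have "(level_radius (Suc n))\<^sup>2 \<le> (norm (p (T (Suc i))))\<^sup>2" using b by (intro power_mono)
        then show ?thesis
          using level_radius_gap(2)[OF less_imp_le[OF \<rho>_pos] \<rho>_le, of n] unfolding n by simp
      qed
      have a1: "norm (p (T i)) \<le> level_radius n"
        unfolding T(3) a_def n_def
        by (intro monoD[OF strict_mono_mono[OF strict_mono_level_radius]]) simp
      obtain t where t: "t \<in> {T i..T (Suc i)}" "p t \<in> tangent_disc u (level_radius n) (\<rho> ?k)"
        using path_hits_tangent_disc[OF contT less_imp_le[OF T(4)] a1 b1 b2 u1 close near] by blast
      have "p t \<in> K n" using t(2) u(1) by (auto simp: K_def n)
      moreover have "n0 \<le> n"
      proof -
        have "n0 \<le> k0 + i" by (simp add: k0_def)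
        also have "\<dots> \<le> n" unfolding n_def using mk[of "k0 + i"] by (rule trans_le_add1)
        finally show ?thesis .
      qed
      moreover have "t \<in> {0..<1}" using t(1) T(1)[of i] T(2)[of "Suc i"] by auto
      ultimately show False using miss by blast
    qed
    then obtain T' where T': "\<And>i. T i < T' i" "\<And>i. T' i < T (Suc i)"
        "\<And>i. \<rho> (k0 + i) / 4 \<le> dist (p (T i)) (p (T' i))" by metis
    obtain C where C: "\<And>n. (\<Sum>i<n. dist (p (T i)) (p (T' i))) \<le> C"
      using interlaced_sums_bounded[of p T T', OF len T(1) T'(1,2) T(2)] by blast
    have "summable (\<lambda>i. \<rho> (k0 + i) / 4)"
    proof (rule summableI_nonneg_bounded)
      show "0 \<le> \<rho> (k0 + i) / 4" for i using \<rho>_pos[of "k0 + i"] by simp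
      show "(\<Sum>i<n. \<rho> (k0 + i) / 4) \<le> C" for n
        using sum_mono[of "{..<n}", OF T'(3)] C[of n] by (rule order_trans)
    qed
    \<comment> \<open>The factor cancels the constants in \<open>\<rho>\<close> and the 1/4, leaving
      a shifted harmonic series.\<close>
    then have "summable (\<lambda>i. (8 * (real m + 3)) * (\<rho> (i + k0) / 4))"
      by (intro summable_mult) (simp add: add.commute)
    also have "(\<lambda>i. (8 * (real m + 3)) * (\<rho> (i + k0) / 4)) = (\<lambda>i. inverse (real (i + Suc k0)))"
    proof
      fix i
      have "8 * M * (1 / (2 * M * N) / 4) = inverse N" if "M \<noteq> 0" for M N :: real
        using that by (simp add: field_simps)
      from this[of "real m + 3" "real (i + k0) + 1"]
      show "8 * (real m + 3) * (\<rho> (i + k0) / 4) = inverse (real (i + Suc k0))"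
        unfolding \<rho>_def by (simp add: add_ac)
    qed
    finally have "summable (\<lambda>i. inverse (real i))"
      using summable_iff_shift[of "\<lambda>i. inverse (real i)" "Suc k0"] by blast
    then show False using not_summable_harmonic[where 'a = real] by simp
  qed
  then show ?thesis using f(1) by blast
qed

end
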